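(* Let $k$ be a field, $B$ a bialgebra over $k$, $\alpha:B\to B$ and $\beta:B\to B^{op,cop}$ morphisms of bialgebras, $C$ a $B$-bimodule coalgebra, and $\mathbb{I}\in C$ an element with $\Delta_C(\mathbb{I})=\mathbb{I}\otimes\mathbb{I}$. Let $\mathcal{K}_{(\alpha,\beta)}^n(C,B)=C^{\otimes n}\otimes B$ for $n\ge0$, with product $$(c^1\otimes\cdots\otimes c^n\otimes b)(c^{n+1}\otimes\cdots\otimes c^{n+m}\otimes b')=c^1\otimes\cdots\otimes c^n\otimes\alpha(b_{(1)})c^{n+1}\beta(b_{(2m+1)})\otimes\cdots\otimes\alpha(b_{(m)})c^{n+m}\beta(b_{(m+2)})\otimes b_{(m+1)}b'$$ and differential $$d(c^1\otimes\cdots\otimes c^n\otimes b)=-(\mathbb{I}\otimes c^1\otimes\cdots\otimes c^n\otimes b)+\sum_{j=1}^n(-1)^{j-1}c^1\otimes\cdots\otimes c^j_{(1)}\otimes c^j_{(2)}\otimes\cdots\otimes c^n\otimes b+(-1)^n c^1\otimes\cdots\otimes c^n\otimes\alpha(b_{(1)})\mathbb{I}\beta(b_{(3)})\otimes b_{(2)}.$$ Then $\mathcal{K}_{(\alpha,\beta)}^*(C,B)$ is a differential graded $k$-algebra.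
   Context: Sweedler notation is used. $B^{op,cop}$ is $B$ with opposite multiplication and opposite comultiplication. A $B$-bimodule coalgebra $C$ is a coalgebra which is a $B$-bimodule such that $\Delta_C$ is a $B$-bimodule map for the diagonal actions: $(bcb')_{(1)}\otimes(bcb')_{(2)}=b_{(1)}c_{(1)}b'_{(1)}\otimes b_{(2)}c_{(2)}b'_{(2)}$. No condition is imposed on $\varepsilon(\mathbb{I})$. A differential graded $k$-algebra is a graded associative unital $k$-algebra with a degree $+1$ differential $d$, $d^2=0$, satisfying $d(\Psi\Phi)=d(\Psi)\Phi+(-1)^{|\Psi|}\Psi d(\Phi)$. *)

theory Defs
  imports
    "HOL-Library.Poly_Mapping"
    "HOL-Algebra.Algebraic_Closure_Type"
begin

section \<open>Tensor products\<close>

text \<open>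
  The ground field is a type of class \<open>field\<close>; a vector space is a type together with a scalar
  multiplication. Tensor products are constructed as usual: the free vector space
  \<open>'x \<Rightarrow>\<^sub>0 'k\<close> on a set \<open>'x\<close> of tuples, modulo the span of the multilinearity relations. A tensor
  is a coset. The tuples are pairs for \<open>V \<otimes> V\<close>, triples for \<open>V \<otimes> V \<otimes> V\<close>, and elements of
  \<open>'c list \<times> 'b\<close> for \<open>\<Oplus>\<^sub>n C\<^sup>\<otimes>\<^sup>n \<otimes> B\<close>.
\<close>

definition fscale :: "'k::field \<Rightarrow> ('x \<Rightarrow>\<^sub>0 'k) \<Rightarrow> ('x \<Rightarrow>\<^sub>0 'k)" where
  "fscale a = Poly_Mapping.map ((*) a)"

lemma lookup_fscale [simp]: "Poly_Mapping.lookup (fscale a t) x = a * Poly_Mapping.lookup t x"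
  by (simp add: fscale_def Poly_Mapping.map.rep_eq when_def)

interpretation free: vector_space "fscale :: 'k::field \<Rightarrow> ('x \<Rightarrow>\<^sub>0 'k) \<Rightarrow> ('x \<Rightarrow>\<^sub>0 'k)"
  by unfold_locales
    (auto intro!: poly_mapping_eqI simp: Poly_Mapping.lookup_add algebra_simps)

abbreviation gen :: "'x \<Rightarrow> ('x \<Rightarrow>\<^sub>0 'k::field)" where
  "gen x \<equiv> Poly_Mapping.single x 1"

definition lin_ext ::
    "('k::field \<Rightarrow> 'v \<Rightarrow> 'v::ab_group_add) \<Rightarrow> ('x \<Rightarrow> 'v) \<Rightarrow> ('x \<Rightarrow>\<^sub>0 'k) \<Rightarrow> 'v" where
  "lin_ext scale f t = (\<Sum>x\<in>Poly_Mapping.keys t. scale (Poly_Mapping.lookup t x) (f x))"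

abbreviation fext :: "('x \<Rightarrow> ('y \<Rightarrow>\<^sub>0 'k::field)) \<Rightarrow> ('x \<Rightarrow>\<^sub>0 'k) \<Rightarrow> ('y \<Rightarrow>\<^sub>0 'k)" where
  "fext \<equiv> lin_ext fscale"

text \<open>
  An element \<open>h\<close> of \<open>S\<close> is a tuple with one entry left open; the relations say that a tuple
  depends linearly on that entry.
\<close>

definition slot_relations ::
    "('k::field \<Rightarrow> 'v \<Rightarrow> 'v::ab_group_add) \<Rightarrow> ('v \<Rightarrow> 'x) set \<Rightarrow> ('x \<Rightarrow>\<^sub>0 'k) set" where
  "slot_relations scale S =
     {gen (h (x + y)) - gen (h x) - gen (h y) | h x y. h \<in> S} \<union>
     {gen (h (scale a x)) - fscale a (gen (h x)) | h a x. h \<in> S}"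

definition null2 :: "('k::field \<Rightarrow> 'v \<Rightarrow> 'v::ab_group_add) \<Rightarrow> ('v \<times> 'v \<Rightarrow>\<^sub>0 'k) set" where
  "null2 s = free.span (slot_relations s
     ({\<lambda>x. (x, v) | v. True} \<union> {\<lambda>x. (u, x) | u. True}))"

definition null3 :: "('k::field \<Rightarrow> 'v \<Rightarrow> 'v::ab_group_add) \<Rightarrow> ('v \<times> 'v \<times> 'v \<Rightarrow>\<^sub>0 'k) set" where
  "null3 s = free.span (slot_relations s
     ({\<lambda>x. (x, v, w) | v w. True} \<union> {\<lambda>x. (u, x, w) | u w. True} \<union> {\<lambda>x. (u, v, x) | u v. True}))"

definition null_words ::
    "('k::field \<Rightarrow> 'c \<Rightarrow> 'c::ab_group_add) \<Rightarrow> ('k \<Rightarrow> 'b \<Rightarrow> 'b::ab_group_add)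
      \<Rightarrow> ('c list \<times> 'b \<Rightarrow>\<^sub>0 'k) set" where
  "null_words sC sB = free.span (
     slot_relations sC {\<lambda>c. (us @ c # vs, b) | us vs b. True} \<union>
     slot_relations sB {\<lambda>b. (cs, b) | cs. True})"

definition coset :: "('x \<Rightarrow>\<^sub>0 'k::field) set \<Rightarrow> ('x \<Rightarrow>\<^sub>0 'k) \<Rightarrow> ('x \<Rightarrow>\<^sub>0 'k) set" where
  "coset N t = {u. u - t \<in> N}"

text \<open>
  Operations on cosets are unions over all representatives, so that they yield a single coset
  exactly when they are independent of the representatives.
\<close>

definition qadd :: "('x \<Rightarrow>\<^sub>0 'k::field) set \<Rightarrow> ('x \<Rightarrow>\<^sub>0 'k) set \<Rightarrow> ('x \<Rightarrow>\<^sub>0 'k) set \<Rightarrow> ('x \<Rightarrow>\<^sub>0 'k) set" where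
  "qadd N S T = (\<Union>s\<in>S. \<Union>t\<in>T. coset N (s + t))"

definition qscale :: "('x \<Rightarrow>\<^sub>0 'k::field) set \<Rightarrow> 'k \<Rightarrow> ('x \<Rightarrow>\<^sub>0 'k) set \<Rightarrow> ('x \<Rightarrow>\<^sub>0 'k) set" where
  "qscale N a S = (\<Union>s\<in>S. coset N (fscale a s))"

definition qmap ::
    "('y \<Rightarrow>\<^sub>0 'k::field) set \<Rightarrow> (('x \<Rightarrow>\<^sub>0 'k) \<Rightarrow> ('y \<Rightarrow>\<^sub>0 'k)) \<Rightarrow> ('x \<Rightarrow>\<^sub>0 'k) set \<Rightarrow> ('y \<Rightarrow>\<^sub>0 'k) set" where
  "qmap N f S = (\<Union>s\<in>S. coset N (f s))"


section \<open>Coalgebras and bialgebras\<close>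

record (overloaded) ('k::zero, 'v) coalg =
  scale :: "'k \<Rightarrow> 'v \<Rightarrow> 'v"
  comul :: "'v \<Rightarrow> ('v \<times> 'v \<Rightarrow>\<^sub>0 'k) set"
  counit :: "'v \<Rightarrow> 'k"

record (overloaded) ('k::zero, 'v) bialg = "('k, 'v) coalg" +
  mul :: "'v \<Rightarrow> 'v \<Rightarrow> 'v"
  unity :: "'v"

record (overloaded) ('k::zero, 'c, 'b) bimod_coalg = "('k, 'c) coalg" +
  lact :: "'b \<Rightarrow> 'c \<Rightarrow> 'c"
  ract :: "'c \<Rightarrow> 'b \<Rightarrow> 'c"

text \<open>
  Sweedler notation: \<open>sweedler C x\<close> is a formal sum of pairs \<open>(x\<^sub>(\<^sub>1\<^sub>), x\<^sub>(\<^sub>2\<^sub>))\<close> representing the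
  tensor \<open>comul C x\<close>.
\<close>

definition sweedler :: "('k::field, 'v, 'm) coalg_scheme \<Rightarrow> 'v \<Rightarrow> ('v \<times> 'v \<Rightarrow>\<^sub>0 'k)" where
  "sweedler C x = (SOME t. t \<in> comul C x)"

text \<open>\<open>sweedlers C n x\<close> is a formal sum of lists \<open>[x\<^sub>(\<^sub>1\<^sub>), \<dots>, x\<^sub>(\<^sub>n\<^sub>+\<^sub>1\<^sub>)]\<close>.\<close>

primrec sweedlers :: "('k::field, 'v, 'm) coalg_scheme \<Rightarrow> nat \<Rightarrow> 'v \<Rightarrow> ('v list \<Rightarrow>\<^sub>0 'k)" where
  "sweedlers C 0 x = gen [x]"
| "sweedlers C (Suc n) x =
     fext (\<lambda>(x1, x2). fext (\<lambda>xs. gen (x1 # xs)) (sweedlers C n x2)) (sweedler C x)"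

locale coalgebra =
  fixes C :: "('k::field, 'v::ab_group_add, 'm) coalg_scheme"
  assumes vector_space: "vector_space (scale C)"
    and comul_tensor: "comul C x \<in> range (coset (null2 (scale C)))"
    and comul_add: "comul C (x + y) = qadd (null2 (scale C)) (comul C x) (comul C y)"
    and comul_scale: "comul C (scale C a x) = qscale (null2 (scale C)) a (comul C x)"
    and counit_linear: "Vector_Spaces.linear (scale C) (*) (counit C)"
    and coassoc:
      "coset (null3 (scale C))
         (fext (\<lambda>(x1, x2). fext (\<lambda>(u, v). gen (u, v, x2)) (sweedler C x1)) (sweedler C x)) =
       coset (null3 (scale C))
         (fext (\<lambda>(x1, x2). fext (\<lambda>(u, v). gen (x1, u, v)) (sweedler C x2)) (sweedler C x))"
    and counit_left:
      "lin_ext (scale C) (\<lambda>(x1, x2). scale C (counit C x1) x2) (sweedler C x) = x"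
    and counit_right:
      "lin_ext (scale C) (\<lambda>(x1, x2). scale C (counit C x2) x1) (sweedler C x) = x"

locale bialgebra = coalgebra B
  for B :: "('k::field, 'b::ab_group_add, 'm) bialg_scheme" +
  assumes mul_linear_right: "Vector_Spaces.linear (scale B) (scale B) (mul B x)"
    and mul_linear_left: "Vector_Spaces.linear (scale B) (scale B) (\<lambda>x. mul B x y)"
    and mul_assoc: "mul B (mul B x y) z = mul B x (mul B y z)"
    and mul_unity_left: "mul B (unity B) x = x"
    and mul_unity_right: "mul B x (unity B) = x"
    and comul_mul: "comul B (mul B x y) = coset (null2 (scale B))
        (fext (\<lambda>(x1, x2). fext (\<lambda>(y1, y2). gen (mul B x1 y1, mul B x2 y2)) (sweedler B y))
          (sweedler B x))"
    and comul_unity: "comul B (unity B) = coset (null2 (scale B)) (gen (unity B, unity B))"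
    and counit_mul: "counit B (mul B x y) = counit B x * counit B y"
    and counit_unity: "counit B (unity B) = 1"

definition bialgebra_hom ::
    "('k::field, 'a::ab_group_add, 'm) bialg_scheme \<Rightarrow> ('k, 'b::ab_group_add, 'n) bialg_scheme
      \<Rightarrow> ('a \<Rightarrow> 'b) \<Rightarrow> bool" where
  "bialgebra_hom A B f \<longleftrightarrow>
     Vector_Spaces.linear (scale A) (scale B) f \<and>
     (\<forall>x y. f (mul A x y) = mul B (f x) (f y)) \<and>
     f (unity A) = unity B \<and>
     (\<forall>x. comul B (f x) = coset (null2 (scale B))
        (fext (\<lambda>(x1, x2). gen (f x1, f x2)) (sweedler A x))) \<and>
     (\<forall>x. counit B (f x) = counit A x)"

definition op_cop ::
    "('k::field, 'b::ab_group_add, 'm) bialg_scheme \<Rightarrow> ('k, 'b, 'm) bialg_scheme" where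
  "op_cop B = B\<lparr>
     comul := (\<lambda>x. qmap (null2 (scale B)) (fext (\<lambda>(x1, x2). gen (x2, x1))) (comul B x)),
     mul := (\<lambda>x y. mul B y x)\<rparr>"

text \<open>
  No compatibility of the counit of \<open>C\<close> with the actions is required: only the comultiplication
  is a bimodule map.
\<close>

locale bimodule_coalgebra = B: bialgebra B + coalgebra C
  for B :: "('k::field, 'b::ab_group_add, 'm) bialg_scheme"
    and C :: "('k, 'c::ab_group_add, 'b, 'n) bimod_coalg_scheme" +
  assumes lact_linear: "Vector_Spaces.linear (scale C) (scale C) (lact C x)"
    and lact_linear_scalar: "Vector_Spaces.linear (scale B) (scale C) (\<lambda>x. lact C x c)"
    and lact_mul: "lact C (mul B x y) c = lact C x (lact C y c)"
    and lact_unity: "lact C (unity B) c = c"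
    and ract_linear: "Vector_Spaces.linear (scale C) (scale C) (\<lambda>c. ract C c x)"
    and ract_linear_scalar: "Vector_Spaces.linear (scale B) (scale C) (ract C c)"
    and ract_mul: "ract C c (mul B x y) = ract C (ract C c x) y"
    and ract_unity: "ract C c (unity B) = c"
    and lact_ract: "ract C (lact C x c) y = lact C x (ract C c y)"
    and comul_bimodule: "comul C (ract C (lact C x c) y) = coset (null2 (scale C))
        (fext (\<lambda>(x1, x2). fext (\<lambda>(c1, c2). fext (\<lambda>(y1, y2).
            gen (ract C (lact C x1 c1) y1, ract C (lact C x2 c2) y2))
          (sweedler B y)) (sweedler C c)) (sweedler B x))"


section \<open>Differential graded algebras\<close>

text \<open>
  An associative unital \<open>R\<close>-algebra \<open>A\<close> that is the direct sum of submodules \<open>G n\<close>, \<open>n \<ge> 0\<close>.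
  (The library's \<open>algebra\<close> locale is restricted to commutative \<open>A\<close>.)
\<close>

locale graded_algebra = base: Ring.field R + Module.module R A + alg: Ring.ring A
  for R :: "('k, 'm) ring_scheme" (structure)
    and A :: "('k, 'a, 'n) module_scheme" (structure) +
  fixes G :: "nat \<Rightarrow> 'a set"
  assumes smult_mult_left:
      "\<lbrakk>a \<in> carrier R; x \<in> carrier A; y \<in> carrier A\<rbrakk>
        \<Longrightarrow> (a \<odot>\<^bsub>A\<^esub> x) \<otimes>\<^bsub>A\<^esub> y = a \<odot>\<^bsub>A\<^esub> (x \<otimes>\<^bsub>A\<^esub> y)"
    and smult_mult_right:
      "\<lbrakk>a \<in> carrier R; x \<in> carrier A; y \<in> carrier A\<rbrakk>
        \<Longrightarrow> x \<otimes>\<^bsub>A\<^esub> (a \<odot>\<^bsub>A\<^esub> y) = a \<odot>\<^bsub>A\<^esub> (x \<otimes>\<^bsub>A\<^esub> y)"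
    and grade_submodule: "submodule (G n) R A"
    and grade_direct_sum:
      "x \<in> carrier A \<Longrightarrow> \<exists>!f. (\<forall>n. f n \<in> G n) \<and> finite {n. f n \<noteq> \<zero>\<^bsub>A\<^esub>} \<and>
        x = finsum A f {n. f n \<noteq> \<zero>\<^bsub>A\<^esub>}"
    and grade_one: "\<one>\<^bsub>A\<^esub> \<in> G 0"
    and grade_mult: "\<lbrakk>x \<in> G m; y \<in> G n\<rbrakk> \<Longrightarrow> x \<otimes>\<^bsub>A\<^esub> y \<in> G (m + n)"

locale dg_algebra = graded_algebra R A G
  for R :: "('k, 'm) ring_scheme" (structure)
    and A :: "('k, 'a, 'n) module_scheme" (structure)
    and G :: "nat \<Rightarrow> 'a set" +
  fixes d :: "'a \<Rightarrow> 'a"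
  assumes diff_closed: "x \<in> carrier A \<Longrightarrow> d x \<in> carrier A"
    and diff_add: "\<lbrakk>x \<in> carrier A; y \<in> carrier A\<rbrakk> \<Longrightarrow> d (x \<oplus>\<^bsub>A\<^esub> y) = d x \<oplus>\<^bsub>A\<^esub> d y"
    and diff_smult: "\<lbrakk>a \<in> carrier R; x \<in> carrier A\<rbrakk> \<Longrightarrow> d (a \<odot>\<^bsub>A\<^esub> x) = a \<odot>\<^bsub>A\<^esub> d x"
    and diff_degree: "x \<in> G n \<Longrightarrow> d x \<in> G (Suc n)"
    and diff_diff: "x \<in> carrier A \<Longrightarrow> d (d x) = \<zero>\<^bsub>A\<^esub>"
    and leibniz: "\<lbrakk>x \<in> G n; y \<in> carrier A\<rbrakk> \<Longrightarrow>
        d (x \<otimes>\<^bsub>A\<^esub> y) =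
          (d x \<otimes>\<^bsub>A\<^esub> y) \<oplus>\<^bsub>A\<^esub> (((\<ominus>\<^bsub>R\<^esub> \<one>\<^bsub>R\<^esub>) [^]\<^bsub>R\<^esub> n) \<odot>\<^bsub>A\<^esub> (x \<otimes>\<^bsub>A\<^esub> d y))"


section \<open>The algebra \<open>K\<^sup>*\<^bsub>(\<alpha>,\<beta>)\<^esub>(C, B)\<close>\<close>

text \<open>
  With \<open>m = length cs'\<close>, the list \<open>bs\<close> runs through \<open>[b\<^sub>(\<^sub>1\<^sub>), \<dots>, b\<^sub>(\<^sub>2\<^sub>m\<^sub>+\<^sub>1\<^sub>)]\<close>, so that \<open>bs ! i\<close> is
  \<open>b\<^sub>(\<^sub>i\<^sub>+\<^sub>1\<^sub>)\<close>.
\<close>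

definition K_mult_gen ::
    "('k::field, 'b::ab_group_add, 'm) bialg_scheme
      \<Rightarrow> ('k, 'c::ab_group_add, 'b, 'n) bimod_coalg_scheme \<Rightarrow> ('b \<Rightarrow> 'b) \<Rightarrow> ('b \<Rightarrow> 'b)
      \<Rightarrow> 'c list \<times> 'b \<Rightarrow> 'c list \<times> 'b \<Rightarrow> ('c list \<times> 'b \<Rightarrow>\<^sub>0 'k)" where
  "K_mult_gen B C \<alpha> \<beta> = (\<lambda>(cs, b) (cs', b'). let m = length cs' in
     fext (\<lambda>bs. gen
        (cs @ map (\<lambda>j. ract C (lact C (\<alpha> (bs ! j)) (cs' ! j)) (\<beta> (bs ! (2 * m - j)))) [0..<m],
         mul B (bs ! m) b'))
       (sweedlers B (2 * m) b))"

definition K_diff_gen ::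
    "('k::field, 'b::ab_group_add, 'm) bialg_scheme
      \<Rightarrow> ('k, 'c::ab_group_add, 'b, 'n) bimod_coalg_scheme \<Rightarrow> ('b \<Rightarrow> 'b) \<Rightarrow> ('b \<Rightarrow> 'b) \<Rightarrow> 'c
      \<Rightarrow> 'c list \<times> 'b \<Rightarrow> ('c list \<times> 'b \<Rightarrow>\<^sub>0 'k)" where
  "K_diff_gen B C \<alpha> \<beta> \<I> = (\<lambda>(cs, b). let n = length cs in
     - gen (\<I> # cs, b)
     + (\<Sum>j = 1..n. fscale ((- 1) ^ (j - 1))
          (fext (\<lambda>(c1, c2). gen (take (j - 1) cs @ [c1, c2] @ drop j cs, b))
             (sweedler C (cs ! (j - 1)))))
     + fscale ((- 1) ^ n)
          (fext (\<lambda>bs. gen (cs @ [ract C (lact C (\<alpha> (bs ! 0)) \<I>) (\<beta> (bs ! 2))], bs ! 1))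
             (sweedlers B 2 b)))"

definition K_algebra ::
    "('k::field, 'b::ab_group_add, 'm) bialg_scheme
      \<Rightarrow> ('k, 'c::ab_group_add, 'b, 'n) bimod_coalg_scheme \<Rightarrow> ('b \<Rightarrow> 'b) \<Rightarrow> ('b \<Rightarrow> 'b)
      \<Rightarrow> ('k, ('c list \<times> 'b \<Rightarrow>\<^sub>0 'k) set) module" where
  "K_algebra B C \<alpha> \<beta> = (let N = null_words (scale C) (scale B) in
     \<lparr>carrier = range (coset N),
      monoid.mult = (\<lambda>S T. \<Union>s\<in>S. \<Union>t\<in>T.
        coset N (fext (\<lambda>g. fext (\<lambda>h. K_mult_gen B C \<alpha> \<beta> g h) t) s)),
      monoid.one = coset N (gen ([], unity B)),
      ring.zero = coset N 0,
      ring.add = qadd N,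
      module.smult = qscale N\<rparr>)"

text \<open>
  The degree \<open>n\<close> part is \<open>C\<^sup>\<otimes>\<^sup>n \<otimes> B\<close>, as every multilinearity relation involves words of one length
  only.
\<close>

definition K_grade ::
    "('k::field, 'b::ab_group_add, 'm) bialg_scheme
      \<Rightarrow> ('k, 'c::ab_group_add, 'b, 'n) bimod_coalg_scheme
      \<Rightarrow> nat \<Rightarrow> ('c list \<times> 'b \<Rightarrow>\<^sub>0 'k) set set" where
  "K_grade B C n = coset (null_words (scale C) (scale B)) `
     {t. \<forall>(cs, b) \<in> Poly_Mapping.keys t. length cs = n}"

definition K_diff ::
    "('k::field, 'b::ab_group_add, 'm) bialg_scheme
      \<Rightarrow> ('k, 'c::ab_group_add, 'b, 'n) bimod_coalg_scheme \<Rightarrow> ('b \<Rightarrow> 'b) \<Rightarrow> ('b \<Rightarrow> 'b) \<Rightarrow> 'c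
      \<Rightarrow> ('c list \<times> 'b \<Rightarrow>\<^sub>0 'k) set \<Rightarrow> ('c list \<times> 'b \<Rightarrow>\<^sub>0 'k) set" where
  "K_diff B C \<alpha> \<beta> \<I> = qmap (null_words (scale C) (scale B)) (fext (K_diff_gen B C \<alpha> \<beta> \<I>))"

end

theory Submission
  imports Defs
begin

text \<open>
  Moving a letter \<open>c\<close> past \<open>b \<in> B\<close> by \<open>b c = \<Sum> \<alpha>(b\<^sub>(\<^sub>1\<^sub>)) c \<beta>(b\<^sub>(\<^sub>3\<^sub>)) b\<^sub>(\<^sub>2\<^sub>)\<close> is compatible
  with the product of \<open>B\<close> and with the coproduct of \<open>C\<close>, so the complex is a twisted tensor product
  of the tensor algebra of \<open>C\<close> with \<open>B\<close>. Left multiplications are operators on words, and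
  associativity becomes a statement about these operators. The differential is
  \<open>d x = D x - \<I> x + (-1)\<^sup>n x \<I>\<close>, where \<open>D\<close> is the graded derivation that extends the coproduct of
  \<open>C\<close> and vanishes on \<open>B\<close>. The graded commutator with \<open>\<I>\<close> is a derivation in any graded algebra,
  \<open>D\<^sup>2 = 0\<close> is the coassociativity of \<open>C\<close>, and \<open>D \<I> = \<I> \<I>\<close> cancels the remaining terms of \<open>d\<^sup>2\<close>.
\<close>


section \<open>Linear maps out of free vector spaces\<close>

text \<open>The source carries a bare function \<open>s\<close> as scalar multiplication, so the
  predicate can be applied slot by slot to tuples whose scalings come from record fields.\<close>

definition lin :: "('k::field \<Rightarrow> 'v \<Rightarrow> 'v::ab_group_add) \<Rightarrow> ('v \<Rightarrow> ('y \<Rightarrow>\<^sub>0 'k)) \<Rightarrow> bool" where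
  "lin s f \<longleftrightarrow> (\<forall>x y. f (x + y) = f x + f y) \<and> (\<forall>a x. f (s a x) = fscale a (f x))"

lemma linI: "(\<And>x y. f (x + y) = f x + f y) \<Longrightarrow> (\<And>a x. f (s a x) = fscale a (f x)) \<Longrightarrow> lin s f"
  by (simp add: lin_def)

lemma lin_add: "lin s f \<Longrightarrow> f (x + y) = f x + f y"
  and lin_scale: "lin s f \<Longrightarrow> f (s a x) = fscale a (f x)"
  by (simp_all add: lin_def)

lemma lin_zero: "lin s f \<Longrightarrow> f 0 = 0"
  using lin_add[of s f 0 0] by simp

lemma lin_minus: "lin s f \<Longrightarrow> f (- x) = - f x"
  using lin_add[of s f x "- x"] lin_zero[of s f] by (simp add: eq_neg_iff_add_eq_0 add.commute)

lemma lin_diff: "lin s f \<Longrightarrow> f (x - y) = f x - f y"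
  using lin_add[of s f x "- y"] by (simp add: lin_minus)

lemma lin_sum: "lin s f \<Longrightarrow> f (sum g A) = (\<Sum>x\<in>A. f (g x))"
  by (induction A rule: infinite_finite_induct) (simp_all add: lin_zero lin_add)

declare free.scale_scale [simp]

lemma fscale_left_commute: "fscale a (fscale b t) = fscale b (fscale a t)"
  by (simp add: mult.commute)

text \<open>Supports may shrink under addition and scaling; padding with zero coefficients lets sums
  over different supports be compared.\<close>

lemma fext_superset:
  "finite A \<Longrightarrow> Poly_Mapping.keys t \<subseteq> A \<Longrightarrow>
    fext f t = (\<Sum>x\<in>A. fscale (Poly_Mapping.lookup t x) (f x))"
  unfolding lin_ext_def by (rule sum.mono_neutral_left) (auto simp: in_keys_iff)

lemma lin_fext:
  fixes f :: "'x \<Rightarrow> ('y \<Rightarrow>\<^sub>0 'k::field)"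
  shows "lin fscale (fext f)"
proof (rule linI)
  fix s t :: "'x \<Rightarrow>\<^sub>0 'k"
  let ?A = "Poly_Mapping.keys s \<union> Poly_Mapping.keys t"
  have "Poly_Mapping.keys (s + t) \<subseteq> ?A"
    by (rule Poly_Mapping.keys_add)
  then show "fext f (s + t) = fext f s + fext f t"
    by (simp add: fext_superset[of ?A] Poly_Mapping.lookup_add free.scale_left_distrib sum.distrib)
next
  fix a and t :: "'x \<Rightarrow>\<^sub>0 'k"
  have "Poly_Mapping.keys (fscale a t) \<subseteq> Poly_Mapping.keys t"
    by (auto simp: in_keys_iff)
  then show "fext f (fscale a t) = fscale a (fext f t)"
    by (simp add: fext_superset[of "Poly_Mapping.keys t"] free.scale_sum_right)
qed

lemmas fext_add [simp] = lin_add[OF lin_fext]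
  and fext_fscale [simp] = lin_scale[OF lin_fext]
  and fext_zero [simp] = lin_zero[OF lin_fext]
  and fext_minus [simp] = lin_minus[OF lin_fext]
  and fext_diff [simp] = lin_diff[OF lin_fext]
  and fext_sum = lin_sum[OF lin_fext]

lemma fext_gen [simp]: "fext f (gen x) = f x"
  by (simp add: lin_ext_def)

lemma fext_fun_add [simp]: "fext (\<lambda>x. f x + g x) t = fext f t + fext g t"
  by (simp add: lin_ext_def free.scale_right_distrib sum.distrib)

lemma fext_fun_zero [simp]: "fext (\<lambda>x. 0) t = 0"
  by (simp add: lin_ext_def)

lemma lin_hom_fext:
  assumes "lin fscale \<phi>"
  shows "\<phi> (fext f t) = fext (\<lambda>x. \<phi> (f x)) t"
  by (simp add: lin_ext_def lin_sum[OF assms] lin_scale[OF assms])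

lemma lin_fscale: "lin fscale (fscale a)"
  by (rule linI) (simp_all add: free.scale_right_distrib fscale_left_commute)

lemma lin_uminus: "lin fscale uminus"
  by (rule linI) (simp_all add: free.scale_minus_right)

lemma fext_fun_fscale [simp]: "fext (\<lambda>x. fscale a (f x)) t = fscale a (fext f t)"
  by (simp add: lin_hom_fext[OF lin_fscale])

lemma fext_fun_minus [simp]: "fext (\<lambda>x. - f x) t = - fext f t"
  by (simp add: lin_hom_fext[OF lin_uminus])

lemma fext_fun_diff [simp]: "fext (\<lambda>x. f x - g x) t = fext f t - fext g t"
  using fext_fun_add[of f "\<lambda>x. - g x" t] by simp

lemma fext_fext: "fext f (fext g t) = fext (\<lambda>x. fext f (g x)) t"
  by (rule lin_hom_fext[OF lin_fext])

lemma fext_swap: "fext (\<lambda>x. fext (\<lambda>y. f x y) t) s = fext (\<lambda>y. fext (\<lambda>x. f x y) s) t"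
  by (simp add: lin_ext_def[of fscale] free.scale_sum_right fscale_left_commute del: free.scale_scale)
     (rule sum.swap)

lemma fext_gen_id [simp]: "fext gen t = t"
proof (rule poly_mapping_eqI)
  fix x
  have "Poly_Mapping.lookup (fext gen t) x
      = (\<Sum>y\<in>Poly_Mapping.keys t. Poly_Mapping.lookup t y * (1 when y = x))"
    by (simp add: lin_ext_def lookup_sum lookup_single when_def)
  also have "\<dots> = Poly_Mapping.lookup t x"
    by (simp add: when_def in_keys_iff if_distrib[of "(*) _"] cong: if_cong)
  finally show "Poly_Mapping.lookup (fext gen t) x = Poly_Mapping.lookup t x" .
qed

lemma lin_eq_fext:
  assumes "lin fscale \<phi>"
  shows "\<phi> t = fext (\<lambda>x. \<phi> (gen x)) t"
  using lin_hom_fext[OF assms, of gen t] by simp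

lemma fext_cong: "(\<And>x. x \<in> Poly_Mapping.keys t \<Longrightarrow> f x = g x) \<Longrightarrow> fext f t = fext g t"
  by (simp add: lin_ext_def)

lemma lin_eqI:
  assumes "lin fscale \<phi>" "lin fscale \<psi>" "\<And>x. \<phi> (gen x) = \<psi> (gen x)"
  shows "\<phi> t = \<psi> t"
  unfolding lin_eq_fext[OF assms(1), of t] lin_eq_fext[OF assms(2), of t] assms(3) ..


section \<open>A projection along a subspace\<close>

text \<open>
  Over a field every subspace of relations is the kernel of a linear projection, so congruences
  modulo the relations can be treated as equations between projected elements.
\<close>

definition proj :: "('x \<Rightarrow>\<^sub>0 'k::field) set \<Rightarrow> ('x \<Rightarrow>\<^sub>0 'k) \<Rightarrow> ('x \<Rightarrow>\<^sub>0 'k)" where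
  "proj N = (SOME p. lin fscale p \<and> (\<forall>t. p t = 0 \<longleftrightarrow> t \<in> N) \<and> (\<forall>t. p (p t) = p t))"

text \<open>Extend a basis of \<open>N\<close> to a basis of the whole space; \<open>p\<close> kills
  the former and fixes the added vectors.\<close>

lemma projection_exists:
  fixes N :: "('x \<Rightarrow>\<^sub>0 'k::field) set"
  assumes N: "free.subspace N"
  shows "\<exists>p. lin fscale p \<and> (\<forall>t. p t = 0 \<longleftrightarrow> t \<in> N) \<and> (\<forall>t. p (p t) = p t)"
proof -
  interpret vector_space_pair "fscale :: 'k \<Rightarrow> ('x \<Rightarrow>\<^sub>0 'k) \<Rightarrow> _" "fscale :: 'k \<Rightarrow> ('x \<Rightarrow>\<^sub>0 'k) \<Rightarrow> _"
    by unfold_locales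
  obtain B where B: "B \<subseteq> N" "free.independent B" "N \<subseteq> free.span B"
    using free.maximal_independent_subset[of N] by blast
  define E where "E = free.extend_basis B"
  have E: "B \<subseteq> E" "free.independent E" "free.span E = UNIV"
    unfolding E_def using B(2)
    by (auto simp: free.extend_basis_superset free.independent_extend_basis)
  define p where "p = construct E (\<lambda>b. if b \<in> B then 0 else b)"
  have linear: "Vector_Spaces.linear fscale fscale p"
    unfolding p_def using E(2) by (rule linear_construct)
  interpret p: Vector_Spaces.linear fscale fscale p by (rule linear)
  have basis: "p b = (if b \<in> B then 0 else b)" if "b \<in> E" for b
    unfolding p_def using construct_basis[OF E(2) that] by simp
  have kernel: "p t = 0" if "t \<in> N" for t
  proof -
    have "t \<in> free.span B" using that B(3) by blast
    then show ?thesis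
      by (induction rule: free.span_induct_alt) (use E(1) basis in \<open>auto simp: p.add p.scale p.zero\<close>)
  qed
  \<comment> \<open>Checked on the basis \<open>E\<close> and spread by linearity. It shows that
    \<open>p t = 0\<close> forces \<open>t \<in> N\<close> and, since \<open>p\<close> vanishes on
    \<open>N\<close>, that \<open>p\<close> is idempotent.\<close>
  have diff: "p t - t \<in> N" for t
  proof -
    have "t \<in> free.span E" using E(3) by simp
    then show ?thesis
    proof (induction rule: free.span_induct_alt)
      case base
      then show ?case using N by (simp add: p.zero free.subspace_0)
    next
      case (step a b t)
      have "p b - b \<in> N"
        using basis[OF step(1)] B(1) N by (auto simp: free.subspace_0 free.subspace_neg)
      then have "fscale a (p b - b) + (p t - t) \<in> N"
        using step N by (blast intro: free.subspace_add free.subspace_scale)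
      then show ?case
        by (simp add: p.add p.scale free.scale_right_diff_distrib algebra_simps)
    qed
  qed
  have "lin fscale p"
    by (rule linI) (simp_all add: p.add p.scale)
  moreover have "p t = 0 \<longleftrightarrow> t \<in> N" for t
    using kernel diff[of t] free.subspace_neg[OF N, of "- t"] by auto
  moreover have "p (p t) = p t" for t
    using kernel[OF diff[of t]] by (simp add: p.diff)
  ultimately show ?thesis by blast
qed

context
  fixes N :: "('x \<Rightarrow>\<^sub>0 'k::field) set"
  assumes N: "free.subspace N"
begin

lemma lin_proj: "lin fscale (proj N)"
  and proj_eq_0_iff: "proj N t = 0 \<longleftrightarrow> t \<in> N"
  and proj_proj: "proj N (proj N t) = proj N t"
proof -
  have "lin fscale (proj N) \<and> (\<forall>t. proj N t = 0 \<longleftrightarrow> t \<in> N) \<and> (\<forall>t. proj N (proj N t) = proj N t)"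
    unfolding proj_def by (rule someI_ex[OF projection_exists[OF N]])
  then show "lin fscale (proj N)" "proj N t = 0 \<longleftrightarrow> t \<in> N" "proj N (proj N t) = proj N t"
    by blast+
qed

lemma proj_eq_iff: "proj N s = proj N t \<longleftrightarrow> s - t \<in> N"
  using lin_diff[OF lin_proj, of s t] proj_eq_0_iff[of "s - t"] by simp

lemma mem_coset_iff: "u \<in> coset N t \<longleftrightarrow> proj N u = proj N t"
  by (simp add: coset_def proj_eq_iff)

lemma mem_coset_self: "t \<in> coset N t"
  by (simp add: mem_coset_iff)

lemma coset_eq_iff: "coset N s = coset N t \<longleftrightarrow> proj N s = proj N t"
  using mem_coset_self[of s] by (auto simp: mem_coset_iff set_eq_iff)

text \<open>Operations on cosets are unions over representatives; equal projections make all members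
  of the union the same coset. Nonemptiness matters because an empty union is no coset.\<close>

lemma UN_coset:
  assumes "S \<noteq> {}" "\<And>s. s \<in> S \<Longrightarrow> proj N (f s) = proj N t"
  shows "(\<Union>s\<in>S. coset N (f s)) = coset N t"
proof -
  have "coset N (f s) = coset N t" if "s \<in> S" for s
    using assms(2)[OF that] by (simp only: coset_eq_iff)
  then have "(\<lambda>s. coset N (f s)) ` S = {coset N t}"
    using assms(1) by blast
  then show ?thesis by simp
qed

lemma qadd_coset: "qadd N (coset N s) (coset N t) = coset N (s + t)"
proof -
  have *: "(\<Union>v\<in>coset N t. coset N (u + v)) = coset N (s + t)" if "u \<in> coset N s" for u
    using that mem_coset_self[of t]
    by (intro UN_coset) (auto simp: mem_coset_iff lin_add[OF lin_proj])
  have "(\<lambda>u. \<Union>v\<in>coset N t. coset N (u + v)) ` coset N s = {coset N (s + t)}"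
    using * mem_coset_self[of s] by blast
  then show ?thesis
    unfolding qadd_def by simp
qed

lemma qscale_coset: "qscale N a (coset N t) = coset N (fscale a t)"
  unfolding qscale_def using mem_coset_self[of t]
  by (intro UN_coset) (auto simp: mem_coset_iff lin_scale[OF lin_proj])

end

text \<open>Representatives of one coset share their projection, so independence of the
  representative only has to be checked against \<open>proj M u\<close>.\<close>

lemma qmap_coset:
  assumes "free.subspace M" "free.subspace N"
    and "\<And>u. proj N (f u) = proj N (f (proj M u))"
  shows "qmap N f (coset M t) = coset N (f t)"
proof -
  have "proj N (f u) = proj N (f t)" if "u \<in> coset M t" for u
    using assms(3)[of u] assms(3)[of t] that by (simp add: mem_coset_iff[OF assms(1)])
  moreover have "coset M t \<noteq> {}"
    using mem_coset_self[OF assms(1), of t] by blast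
  ultimately show ?thesis
    unfolding qmap_def by (intro UN_coset[OF assms(2)])
qed


section \<open>Multilinear functions\<close>

lemma fext_kernel_subspace: "free.subspace {t. fext f t = 0}"
  by (rule free.subspaceI) auto

lemma slot_relations_subset_kernel:
  assumes "\<And>h. h \<in> S \<Longrightarrow> lin s (\<lambda>x. f (h x))"
  shows "slot_relations s S \<subseteq> {t. fext f t = 0}"
proof
  fix t
  assume "t \<in> slot_relations s S"
  then consider (add) h x y where "h \<in> S" "t = gen (h (x + y)) - gen (h x) - gen (h y)"
    | (scale) h a x where "h \<in> S" "t = gen (h (s a x)) - fscale a (gen (h x))"
    unfolding slot_relations_def by blast
  then show "t \<in> {t. fext f t = 0}"
  proof cases
    case add
    have "f (h (x + y)) = f (h x) + f (h y)"
      using assms[OF add(1)] by (rule lin_add)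
    then show ?thesis by (simp add: add(2))
  next
    case scale
    have "f (h (s a x)) = fscale a (f (h x))"
      using assms[OF scale(1)] by (rule lin_scale)
    then show ?thesis by (simp add: scale(2))
  qed
qed

text \<open>Universal property of the tensor product: the kernel of \<open>fext f\<close> is a
  subspace, so it contains the span of the relations once it contains the relations.\<close>

lemma fext_eq_0_if_slotwise_linear:
  assumes "\<And>h. h \<in> S \<Longrightarrow> lin s (\<lambda>x. f (h x))" and "t \<in> free.span (slot_relations s S)"
  shows "fext f t = 0"
proof -
  have "slot_relations s S \<subseteq> {t. fext f t = 0}"
    by (rule slot_relations_subset_kernel) (rule assms(1))
  then have "free.span (slot_relations s S) \<subseteq> {t. fext f t = 0}"
    by (rule free.span_minimal) (rule fext_kernel_subspace)
  then show ?thesis using assms(2) by blast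
qed

text \<open>The converse direction: modulo a subspace that contains the relations, the tautological
  map on tuples is itself linear in each slot.\<close>

lemma lin_proj_slot:
  assumes N: "free.subspace N" and "slot_relations s S \<subseteq> N" and "h \<in> S"
  shows "lin s (\<lambda>x. proj N (gen (h x)))"
proof (rule linI)
  fix x y
  have "gen (h (x + y)) - gen (h x) - gen (h y) \<in> N"
    using assms unfolding slot_relations_def by blast
  then show "proj N (gen (h (x + y))) = proj N (gen (h x)) + proj N (gen (h y))"
    by (simp add: lin_add[OF lin_proj[OF N], symmetric] proj_eq_iff[OF N] diff_diff_eq)
next
  fix a x
  have "gen (h (s a x)) - fscale a (gen (h x)) \<in> N"
    using assms unfolding slot_relations_def by blast
  then show "proj N (gen (h (s a x))) = fscale a (proj N (gen (h x)))"
    by (simp add: lin_scale[OF lin_proj[OF N], symmetric] proj_eq_iff[OF N])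
qed

definition bilin ::
    "('k::field \<Rightarrow> 'u \<Rightarrow> 'u::ab_group_add) \<Rightarrow> ('k \<Rightarrow> 'v \<Rightarrow> 'v::ab_group_add)
      \<Rightarrow> ('u \<Rightarrow> 'v \<Rightarrow> ('y \<Rightarrow>\<^sub>0 'k)) \<Rightarrow> bool" where
  "bilin s1 s2 f \<longleftrightarrow> (\<forall>v. lin s1 (\<lambda>u. f u v)) \<and> (\<forall>u. lin s2 (f u))"

definition trilin ::
    "('k::field \<Rightarrow> 'v \<Rightarrow> 'v::ab_group_add) \<Rightarrow> ('v \<Rightarrow> 'v \<Rightarrow> 'v \<Rightarrow> ('y \<Rightarrow>\<^sub>0 'k)) \<Rightarrow> bool" where
  "trilin s f \<longleftrightarrow> (\<forall>v w. lin s (\<lambda>u. f u v w)) \<and> (\<forall>u w. lin s (\<lambda>v. f u v w)) \<and> (\<forall>u v. lin s (f u v))"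

lemma null2_subspace: "free.subspace (null2 s)"
  unfolding null2_def by (rule free.subspace_span)

lemma null3_subspace: "free.subspace (null3 s)"
  unfolding null3_def by (rule free.subspace_span)

lemma null_words_subspace: "free.subspace (null_words sC sB)"
  unfolding null_words_def by (rule free.subspace_span)

lemma fext_null2:
  assumes "bilin s s f" "t - t' \<in> null2 s"
  shows "fext (case_prod f) t = fext (case_prod f) t'"
proof -
  have "fext (case_prod f) (t - t') = 0"
    using assms(2) unfolding null2_def
    by (rule fext_eq_0_if_slotwise_linear[rotated]) (use assms(1) in \<open>auto simp: bilin_def\<close>)
  then show ?thesis by simp
qed

lemma fext_null3:
  assumes "trilin s f" "t - t' \<in> null3 s"
  shows "fext (\<lambda>(x, y, z). f x y z) t = fext (\<lambda>(x, y, z). f x y z) t'"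
proof -
  have "fext (\<lambda>(x, y, z). f x y z) (t - t') = 0"
    using assms(2) unfolding null3_def
    by (rule fext_eq_0_if_slotwise_linear[rotated]) (use assms(1) in \<open>auto simp: trilin_def\<close>)
  then show ?thesis by simp
qed

section \<open>Sweedler sums\<close>

text \<open>\<open>sw C f x\<close> is the Sweedler sum \<open>\<Sum> f x\<^sub>(\<^sub>1\<^sub>) x\<^sub>(\<^sub>2\<^sub>)\<close>; it is meaningful for bilinear \<open>f\<close>.\<close>

definition sw ::
    "('k::field, 'v, 'm) coalg_scheme \<Rightarrow> ('v \<Rightarrow> 'v \<Rightarrow> ('y \<Rightarrow>\<^sub>0 'k)) \<Rightarrow> 'v \<Rightarrow> ('y \<Rightarrow>\<^sub>0 'k)" where
  "sw C f x = fext (case_prod f) (sweedler C x)"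

text \<open>
  The argument of \<open>sw C f\<close> is left out here because nested Sweedler sums occur eta-contracted.
\<close>

lemma sw_fun_add [simp]: "sw C (\<lambda>u v. f u v + g u v) = (\<lambda>x. sw C f x + sw C g x)"
  and sw_fun_fscale [simp]: "sw C (\<lambda>u v. fscale a (f u v)) = (\<lambda>x. fscale a (sw C f x))"
  and sw_fun_zero [simp]: "sw C (\<lambda>u v. 0) = (\<lambda>x. 0)"
  and sw_fun_minus [simp]: "sw C (\<lambda>u v. - f u v) = (\<lambda>x. - sw C f x)"
  and sw_fun_diff [simp]: "sw C (\<lambda>u v. f u v - g u v) = (\<lambda>x. sw C f x - sw C g x)"
  unfolding sw_def fun_eq_iff by (simp_all add: case_prod_beta')

lemma lin_hom_sw:
  assumes "lin fscale \<phi>"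
  shows "\<phi> (sw C f x) = sw C (\<lambda>u v. \<phi> (f u v)) x"
  unfolding sw_def lin_hom_fext[OF assms] by (simp add: case_prod_beta')

lemma sw_swap:
  "sw C (\<lambda>u v. sw D (\<lambda>y z. f u v y z) b) a = sw D (\<lambda>y z. sw C (\<lambda>u v. f u v y z) a) b"
  unfolding sw_def by (simp add: case_prod_beta' fext_swap[of _ "sweedler D b"])

lemma bilin_proj_gen: "bilin s s (\<lambda>u v. proj (null2 s) (gen (u, v)))"
proof -
  let ?S = "{\<lambda>x. (x, v) | v. True} \<union> {\<lambda>x. (u, x) | u. True}"
  have slot: "lin s (\<lambda>x. proj (null2 s) (gen (h x)))" if "h \<in> ?S" for h
    using null2_subspace _ that
    by (rule lin_proj_slot) (unfold null2_def, rule free.span_superset)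
  show ?thesis
    unfolding bilin_def using slot[of "\<lambda>x. (x, v)" for v] slot[of "Pair u" for u] by auto
qed

lemmas multilinear_defs = lin_def bilin_def trilin_def

context coalgebra
begin

text \<open>By \<open>comul_tensor\<close> the coproduct is a nonempty coset, so the choice made in
  \<open>sweedler\<close> is a genuine representative.\<close>

lemma comul_sweedler: "comul C x = coset (null2 (scale C)) (sweedler C x)"
proof -
  obtain t where t: "comul C x = coset (null2 (scale C)) t"
    using comul_tensor by blast
  then have "sweedler C x \<in> comul C x"
    unfolding sweedler_def by (metis someI mem_coset_self null2_subspace)
  then show ?thesis
    unfolding t by (simp add: mem_coset_iff coset_eq_iff null2_subspace)
qed

text \<open>A bilinear \<open>f\<close> cannot see which representative was chosen, so every formula
  for \<open>comul\<close> becomes a rule for Sweedler sums.\<close>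

lemma sw_eqI:
  assumes "bilin (scale C) (scale C) f" "comul C x = coset (null2 (scale C)) t"
  shows "sw C f x = fext (case_prod f) t"
  unfolding sw_def
proof (rule fext_null2[OF assms(1)])
  have "coset (null2 (scale C)) (sweedler C x) = coset (null2 (scale C)) t"
    using assms(2) by (simp add: comul_sweedler)
  then show "sweedler C x - t \<in> null2 (scale C)"
    by (simp add: coset_eq_iff null2_subspace proj_eq_iff)
qed

lemma lin_sw:
  assumes "bilin (scale C) (scale C) f"
  shows "lin (scale C) (sw C f)"
proof (rule linI)
  fix x y
  have "comul C (x + y) = coset (null2 (scale C)) (sweedler C x + sweedler C y)"
    unfolding comul_add comul_sweedler[of x] comul_sweedler[of y] by (rule qadd_coset[OF null2_subspace])
  from sw_eqI[OF assms this] show "sw C f (x + y) = sw C f x + sw C f y"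
    by (simp add: sw_def)
next
  fix a x
  have "comul C (scale C a x) = coset (null2 (scale C)) (fscale a (sweedler C x))"
    unfolding comul_scale comul_sweedler[of x] by (rule qscale_coset[OF null2_subspace])
  from sw_eqI[OF assms this] show "sw C f (scale C a x) = fscale a (sw C f x)"
    by (simp add: sw_def)
qed

lemmas sw_add = lin_add[OF lin_sw]
  and sw_scale = lin_scale[OF lin_sw]

text \<open>Coassociativity holds only modulo \<open>null3\<close>; a trilinear \<open>f\<close>
  factors through that quotient and turns it into an equation.\<close>

lemma sw_coassoc:
  assumes "trilin (scale C) f"
  shows "sw C (\<lambda>y w. sw C (\<lambda>u v. f u v w) y) x = sw C (\<lambda>u y. sw C (\<lambda>v w. f u v w) y) x"
proof -
  let ?l = "fext (\<lambda>(x1, x2). fext (\<lambda>(u, v). gen (u, v, x2)) (sweedler C x1)) (sweedler C x)"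
  let ?r = "fext (\<lambda>(x1, x2). fext (\<lambda>(u, v). gen (x1, u, v)) (sweedler C x2)) (sweedler C x)"
  have "?l - ?r \<in> null3 (scale C)"
    using coassoc[of x] by (simp add: coset_eq_iff null3_subspace proj_eq_iff)
  from fext_null3[OF assms this] show ?thesis
    by (simp add: sw_def fext_fext case_prod_beta')
qed

end

section \<open>Sweedler sums of products and of images under bialgebra maps\<close>

context bialgebra
begin

lemma sw_mul:
  assumes "bilin (scale B) (scale B) f"
  shows "sw B f (mul B x y) = sw B (\<lambda>x1 x2. sw B (\<lambda>y1 y2. f (mul B x1 y1) (mul B x2 y2)) y) x"
  unfolding sw_eqI[OF assms comul_mul] by (simp add: sw_def fext_fext case_prod_beta')

lemma sw_unity:
  assumes "bilin (scale B) (scale B) f"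
  shows "sw B f (unity B) = f (unity B) (unity B)"
  unfolding sw_eqI[OF assms comul_unity] by simp

lemma mul_add_left [simp]: "mul B (x + y) z = mul B x z + mul B y z"
  and mul_scale_left [simp]: "mul B (scale B a x) z = scale B a (mul B x z)"
  and mul_add_right [simp]: "mul B z (x + y) = mul B z x + mul B z y"
  and mul_scale_right [simp]: "mul B z (scale B a x) = scale B a (mul B z x)"
  using mul_linear_left[of z] mul_linear_right[of z]
  by (simp_all add: Vector_Spaces.linear.axioms linear_iff_module_hom module_hom_iff)

lemma sw_hom:
  assumes "bialgebra_hom B B \<alpha>" "bilin (scale B) (scale B) f"
  shows "sw B f (\<alpha> x) = sw B (\<lambda>x1 x2. f (\<alpha> x1) (\<alpha> x2)) x"
proof -
  have "comul B (\<alpha> x)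
      = coset (null2 (scale B)) (fext (\<lambda>(x1, x2). gen (\<alpha> x1, \<alpha> x2)) (sweedler B x))"
    using assms(1) by (simp add: bialgebra_hom_def)
  from sw_eqI[OF assms(2) this] show ?thesis
    by (simp add: sw_def fext_fext case_prod_beta')
qed

text \<open>The coproduct of \<open>op_cop B\<close> flips representatives. The flip respects the
  bilinearity relations, so it can be computed on the representative
  \<open>sweedler B (\<beta> x)\<close>.\<close>

lemma sw_antihom:
  assumes "bialgebra_hom B (op_cop B) \<beta>" "bilin (scale B) (scale B) f"
  shows "sw B f (\<beta> x) = sw B (\<lambda>x1 x2. f (\<beta> x2) (\<beta> x1)) x"
proof -
  let ?N = "null2 (scale B)" and ?flip = "fext (\<lambda>(x1, x2). gen (x2, x1))"
  note N = null2_subspace[of "scale B"]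
  have "proj ?N (?flip u) = proj ?N (?flip (proj ?N u))" for u
  proof -
    have "bilin (scale B) (scale B) (\<lambda>x1 x2. proj ?N (gen (x2, x1)))"
      using bilin_proj_gen[of "scale B"] by (simp add: bilin_def)
    moreover have "u - proj ?N u \<in> ?N"
      by (simp flip: proj_eq_iff[OF N] add: proj_proj[OF N])
    ultimately have "fext (\<lambda>(x1, x2). proj ?N (gen (x2, x1))) u
        = fext (\<lambda>(x1, x2). proj ?N (gen (x2, x1))) (proj ?N u)"
      by (rule fext_null2)
    then show ?thesis
      by (simp add: lin_hom_fext[OF lin_proj[OF N]] case_prod_beta')
  qed
  then have "qmap ?N ?flip (comul B (\<beta> x)) = coset ?N (?flip (sweedler B (\<beta> x)))"
    unfolding comul_sweedler by (rule qmap_coset[OF N N])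
  from this[symmetric] have "coset ?N (?flip (sweedler B (\<beta> x)))
      = coset ?N (fext (\<lambda>(x1, x2). gen (\<beta> x1, \<beta> x2)) (sweedler B x))"
    using assms(1) by (simp add: bialgebra_hom_def op_cop_def)
  then have "?flip (sweedler B (\<beta> x)) - fext (\<lambda>(x1, x2). gen (\<beta> x1, \<beta> x2)) (sweedler B x) \<in> ?N"
    by (simp add: coset_eq_iff[OF N] proj_eq_iff[OF N])
  \<comment> \<open>Evaluating \<open>f\<close> with exchanged arguments undoes the flip on the left
    and reverses the two factors on the right.\<close>
  moreover have "bilin (scale B) (scale B) (\<lambda>x1 x2. f x2 x1)"
    using assms(2) by (simp add: bilin_def)
  ultimately show ?thesis
    using fext_null2 by (fastforce simp add: sw_def fext_fext case_prod_beta')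
qed

end

section \<open>The two-sided action of \<open>B\<close> on \<open>C\<close> twisted by
  \<open>\<alpha>\<close> and \<open>\<beta>\<close>\<close>

locale twisted_coefficients = bimodule_coalgebra B C
  for B :: "('k::field, 'b::ab_group_add, 'm) bialg_scheme"
    and C :: "('k, 'c::ab_group_add, 'b, 'n) bimod_coalg_scheme" +
  fixes \<alpha> \<beta> :: "'b \<Rightarrow> 'b" and \<I> :: 'c
  assumes \<alpha>: "bialgebra_hom B B \<alpha>"
    and \<beta>: "bialgebra_hom B (op_cop B) \<beta>"
    and grouplike: "comul C \<I> = coset (null2 (scale C)) (gen (\<I>, \<I>))"
begin

abbreviation sB where "sB \<equiv> scale B"
abbreviation sC where "sC \<equiv> scale C"

definition Q :: "'b \<Rightarrow> 'c \<Rightarrow> 'b \<Rightarrow> 'c" where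
  "Q x c z = ract C (lact C (\<alpha> x) c) (\<beta> z)"

lemma \<alpha>_add: "\<alpha> (x + y) = \<alpha> x + \<alpha> y"
  and \<alpha>_scale: "\<alpha> (sB a x) = sB a (\<alpha> x)"
  and \<alpha>_mul: "\<alpha> (mul B x y) = mul B (\<alpha> x) (\<alpha> y)"
  and \<alpha>_unity: "\<alpha> (unity B) = unity B"
  using \<alpha> by (simp_all add: bialgebra_hom_def linear_iff_module_hom module_hom_iff)

lemma \<beta>_add: "\<beta> (x + y) = \<beta> x + \<beta> y"
  and \<beta>_scale: "\<beta> (sB a x) = sB a (\<beta> x)"
  and \<beta>_mul: "\<beta> (mul B x y) = mul B (\<beta> y) (\<beta> x)"
  and \<beta>_unity: "\<beta> (unity B) = unity B"
  using \<beta> by (simp_all add: bialgebra_hom_def linear_iff_module_hom module_hom_iff op_cop_def)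

lemma act_add:
  "lact C x (c + c') = lact C x c + lact C x c'" "lact C (x + y) c = lact C x c + lact C y c"
  "ract C (c + c') x = ract C c x + ract C c' x" "ract C c (x + y) = ract C c x + ract C c y"
  and act_scale:
  "lact C x (sC a c) = sC a (lact C x c)" "lact C (sB a x) c = sC a (lact C x c)"
  "ract C (sC a c) x = sC a (ract C c x)" "ract C c (sB a x) = sC a (ract C c x)"
  using lact_linear[of x] lact_linear_scalar[of c] ract_linear[of x] ract_linear_scalar[of c]
  by (simp_all add: linear_iff_module_hom module_hom_iff)

lemma Q_add [simp]: "Q (x + x') c z = Q x c z + Q x' c z"
  "Q x (c + c') z = Q x c z + Q x c' z" "Q x c (z + z') = Q x c z + Q x c z'"
  and Q_scale [simp]: "Q (sB a x) c z = sC a (Q x c z)"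
  "Q x (sC a c) z = sC a (Q x c z)" "Q x c (sB a z) = sC a (Q x c z)"
  by (simp_all add: Q_def \<alpha>_add \<beta>_add act_add \<alpha>_scale \<beta>_scale act_scale)

text \<open>Since \<open>\<beta>\<close> reverses products, the right action becomes a left action
  in the last argument: both outer arguments multiply in the same order.\<close>

lemma Q_mul: "Q (mul B x y) c (mul B x' y') = Q x (Q y c y') x'"
  by (simp add: Q_def \<alpha>_mul \<beta>_mul lact_mul ract_mul lact_ract)

lemma Q_unity [simp]: "Q (unity B) c (unity B) = c"
  by (simp add: Q_def \<alpha>_unity \<beta>_unity lact_unity ract_unity)

text \<open>The bimodule condition on the coproduct of \<open>C\<close>, pulled back along
  \<open>\<alpha>\<close> and \<open>\<beta>\<close>. As \<open>\<beta>\<close> reverses coproducts,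
  \<open>z2\<close> accompanies the first letter and \<open>z1\<close> the second, so the factors
  are nested from outside to inside.\<close>

lemma sw_Q:
  assumes f: "bilin sC sC f"
  shows "sw C f (Q x c z)
      = sw B (\<lambda>x1 x2. sw C (\<lambda>c1 c2. sw B (\<lambda>z1 z2. f (Q x1 c1 z2) (Q x2 c2 z1)) z) c) x"
proof -
  have "sw C f (Q x c z) = sw B (\<lambda>x1 x2. sw C (\<lambda>c1 c2. sw B (\<lambda>z1 z2.
      f (ract C (lact C x1 c1) z1) (ract C (lact C x2 c2) z2)) (\<beta> z)) c) (\<alpha> x)"
    unfolding Q_def sw_eqI[OF f comul_bimodule] by (simp add: sw_def fext_fext case_prod_beta')
  also have "\<dots> = sw B (\<lambda>x1 x2. sw C (\<lambda>c1 c2. sw B (\<lambda>z1 z2.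
      f (ract C (lact C (\<alpha> x1) c1) z1) (ract C (lact C (\<alpha> x2) c2) z2)) (\<beta> z)) c) x"
    by (rule B.sw_hom[OF \<alpha>]) (use f in \<open>simp add: multilinear_defs act_add act_scale\<close>)
  also have "\<dots> = sw B (\<lambda>x1 x2. sw C (\<lambda>c1 c2. sw B (\<lambda>z1 z2. f (Q x1 c1 z2) (Q x2 c2 z1)) z) c) x"
    unfolding Q_def
    by (subst B.sw_antihom[OF \<beta>]) (use f in \<open>simp_all add: multilinear_defs act_add act_scale\<close>)
  finally show ?thesis .
qed

lemma sw_grouplike: "bilin sC sC f \<Longrightarrow> sw C f \<I> = f \<I> \<I>"
  by (simp add: sw_eqI[OF _ grouplike])

end

section \<open>Operators on words\<close>

definition wlin ::
    "('k::field \<Rightarrow> 'c \<Rightarrow> 'c::ab_group_add) \<Rightarrow> ('k \<Rightarrow> 'b \<Rightarrow> 'b::ab_group_add)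
      \<Rightarrow> ('c list \<times> 'b \<Rightarrow> ('y \<Rightarrow>\<^sub>0 'k)) \<Rightarrow> bool" where
  "wlin sC sB f \<longleftrightarrow>
     (\<forall>us vs b. lin sC (\<lambda>c. f (us @ c # vs, b))) \<and> (\<forall>cs. lin sB (\<lambda>b. f (cs, b)))"

lemma wlinI:
  assumes "\<And>us vs b. lin sC (\<lambda>c. f (us @ c # vs, b))" "\<And>cs. lin sB (\<lambda>b. f (cs, b))"
  shows "wlin sC sB f"
  using assms by (simp add: wlin_def)

lemma fext_null_words:
  assumes f: "wlin sC sB f" and t: "t \<in> null_words sC sB"
  shows "fext f t = 0"
proof -
  let ?SC = "{\<lambda>c. (us @ c # vs, b) | us vs b. True}" and ?SB = "{\<lambda>b. (cs, b) | cs. True}"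
  have "slot_relations sC ?SC \<subseteq> {t. fext f t = 0}" "slot_relations sB ?SB \<subseteq> {t. fext f t = 0}"
    using f by (auto simp: wlin_def intro!: slot_relations_subset_kernel)
  then have "null_words sC sB \<subseteq> {t. fext f t = 0}"
    unfolding null_words_def by (intro free.span_minimal fext_kernel_subspace) auto
  then show ?thesis using t by blast
qed

lemma wlin_proj_gen: "wlin sC sB (\<lambda>g. proj (null_words sC sB) (gen g))"
proof (rule wlinI)
  fix us vs b
  let ?S = "{\<lambda>c. (us @ c # vs, b) | us vs b. True}"
  have "slot_relations sC ?S \<subseteq> null_words sC sB"
    unfolding null_words_def by (meson Un_upper1 free.span_superset subset_trans)
  from lin_proj_slot[OF null_words_subspace this, of "\<lambda>c. (us @ c # vs, b)"]
  show "lin sC (\<lambda>c. proj (null_words sC sB) (gen (us @ c # vs, b)))" by blast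
next
  fix cs
  let ?S = "{\<lambda>b. (cs, b) | cs. True}"
  have "slot_relations sB ?S \<subseteq> null_words sC sB"
    unfolding null_words_def by (meson Un_upper2 free.span_superset subset_trans)
  from lin_proj_slot[OF null_words_subspace this, of "\<lambda>b. (cs, b)"]
  show "lin sB (\<lambda>b. proj (null_words sC sB) (gen (cs, b)))" by blast
qed

context twisted_coefficients
begin

abbreviation N where "N \<equiv> null_words sC sB"
abbreviation pr where "pr \<equiv> proj N"
abbreviation W where "W cs b \<equiv> pr (gen (cs, b))"

lemmas pr_add [simp] = lin_add[OF lin_proj[OF null_words_subspace[of sC sB]]]
  and pr_fscale [simp] = lin_scale[OF lin_proj[OF null_words_subspace[of sC sB]]]
  and pr_zero [simp] = lin_zero[OF lin_proj[OF null_words_subspace[of sC sB]]]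
  and pr_minus [simp] = lin_minus[OF lin_proj[OF null_words_subspace[of sC sB]]]
  and pr_diff [simp] = lin_diff[OF lin_proj[OF null_words_subspace[of sC sB]]]
  and pr_sum = lin_sum[OF lin_proj[OF null_words_subspace[of sC sB]]]
  and pr_fext = lin_hom_fext[OF lin_proj[OF null_words_subspace[of sC sB]]]
  and pr_sw = lin_hom_sw[OF lin_proj[OF null_words_subspace[of sC sB]]]
  and pr_pr [simp] = proj_proj[OF null_words_subspace[of sC sB]]

lemma fext_pr:
  assumes "wlin sC sB f"
  shows "fext f (pr t) = fext f t"
proof -
  have "pr t - t \<in> N"
    by (simp flip: proj_eq_iff[OF null_words_subspace])
  from fext_null_words[OF assms this] show ?thesis by simp
qed

lemma W_add_letter [simp]: "W (us @ (x + y) # vs) b = W (us @ x # vs) b + W (us @ y # vs) b"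
  and W_scale_letter [simp]: "W (us @ sC a x # vs) b = fscale a (W (us @ x # vs) b)"
  and W_add_coeff [simp]: "W cs (b + b') = W cs b + W cs b'"
  and W_scale_coeff [simp]: "W cs (sB a b) = fscale a (W cs b)"
  using wlin_proj_gen[of sC sB] unfolding wlin_def lin_def by blast+

text \<open>The same multilinearity in the shapes that arise once a prefix of the word is written
  out letter by letter.\<close>

lemma W_add_Cons [simp]: "W ((x + y) # vs) b = W (x # vs) b + W (y # vs) b"
  and W_scale_Cons [simp]: "W (sC a x # vs) b = fscale a (W (x # vs) b)"
  and W_add_Cons_letter [simp]: "W (c # us @ (x + y) # vs) b = W (c # us @ x # vs) b + W (c # us @ y # vs) b"
  and W_scale_Cons_letter [simp]: "W (c # us @ sC a x # vs) b = fscale a (W (c # us @ x # vs) b)"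
  using W_add_letter[of "[]"] W_scale_letter[of "[]"] W_add_letter[of "c # us"] W_scale_letter[of "c # us"]
  by simp_all

text \<open>Left multiplication by a letter. Its values are projected, so identities in the quotient
  become plain equations between operators.\<close>

definition L :: "'c \<Rightarrow> ('c list \<times> 'b \<Rightarrow>\<^sub>0 'k) \<Rightarrow> ('c list \<times> 'b \<Rightarrow>\<^sub>0 'k)" where
  "L c = fext (\<lambda>(cs, b). W (c # cs) b)"

lemma L_gen [simp]: "L c (gen (cs, b)) = W (c # cs) b"
  by (simp add: L_def)

lemma L_pr [simp]: "L c (pr t) = L c t"
  unfolding L_def by (rule fext_pr) (simp add: wlin_def lin_def)

lemma lin_L: "lin fscale (L c)"
  unfolding L_def by (rule lin_fext)

lemmas L_add [simp] = lin_add[OF lin_L] and L_fscale [simp] = lin_scale[OF lin_L]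
  and L_zero [simp] = lin_zero[OF lin_L] and L_minus [simp] = lin_minus[OF lin_L]
  and L_diff [simp] = lin_diff[OF lin_L] and L_sw = lin_hom_sw[OF lin_L]
  and L_fext = lin_hom_fext[OF lin_L]

lemma L_add_letter [simp]: "L (c + c') t = L c t + L c' t"
  and L_scale_letter [simp]: "L (sC a c) t = fscale a (L c t)"
  unfolding L_def
  by (simp_all add: case_prod_beta' flip: fext_fun_add fext_fun_fscale)

lemma pr_L [simp]: "pr (L c t) = L c t"
  unfolding L_def pr_fext by (simp add: case_prod_beta')

text \<open>Every word arises from an empty one by prefixing letters, so induction on the word
  suffices. A family indexed by \<open>i\<close> is compared at once because passing a letter may
  change the index, as \<open>A x\<close> turns into various \<open>A x2\<close>.\<close>

lemma operator_eqI:
  fixes \<phi> \<psi> :: "'i \<Rightarrow> ('c list \<times> 'b \<Rightarrow>\<^sub>0 'k) \<Rightarrow> ('y \<Rightarrow>\<^sub>0 'k)"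
  assumes "\<And>i. lin fscale (\<phi> i)" "\<And>i. lin fscale (\<psi> i)"
    and "\<And>i t. \<phi> i (pr t) = \<phi> i t" "\<And>i t. \<psi> i (pr t) = \<psi> i t"
    and "\<And>i b. \<phi> i (W [] b) = \<psi> i (W [] b)"
    and "\<And>i c t. (\<And>i. \<phi> i t = \<psi> i t) \<Longrightarrow> \<phi> i (L c t) = \<psi> i (L c t)"
  shows "\<phi> i t = \<psi> i t"
proof (rule lin_eqI[OF assms(1,2)])
  fix g :: "'c list \<times> 'b"
  obtain cs b where g: "g = (cs, b)" by fastforce
  have "\<phi> i (gen (cs, b)) = \<psi> i (gen (cs, b))" for i
  proof (induction cs arbitrary: i)
    case Nil
    then show ?case using assms(5)[of i b] by (simp only: assms(3,4))
  next
    case (Cons c cs)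
    from assms(6)[OF this, of i c] show ?case by (simp only: L_gen assms(3,4))
  qed
  then show "\<phi> i (gen g) = \<psi> i (gen g)" by (simp add: g)
qed

section \<open>Left multiplication by elements of \<open>B\<close>\<close>

abbreviation sw3 where
  "sw3 f x \<equiv> sw B (\<lambda>x1 y. sw B (\<lambda>x2 x3. f x1 x2 x3) y) x"

lemmas swB_simps [simp] = B.sw_add B.sw_scale
lemmas swC_simps [simp] = sw_add sw_scale

text \<open>
  \<open>A x\<close> is left multiplication by \<open>x\<close>: a letter is passed by
  \<open>x c = \<Sum> \<alpha>(x\<^sub>(\<^sub>1\<^sub>)) c \<beta>(x\<^sub>(\<^sub>3\<^sub>)) x\<^sub>(\<^sub>2\<^sub>)\<close>.
\<close>

primrec A_word :: "'c list \<Rightarrow> 'b \<Rightarrow> 'b \<Rightarrow> ('c list \<times> 'b \<Rightarrow>\<^sub>0 'k)" where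
  "A_word [] x b = W [] (mul B x b)"
| "A_word (c # cs) x b = sw3 (\<lambda>x1 x2 x3. L (Q x1 c x3) (A_word cs x2 b)) x"

lemma A_word_add_left [simp]: "A_word cs (x + y) b = A_word cs x b + A_word cs y b"
  and A_word_scale_left [simp]: "A_word cs (sB a x) b = fscale a (A_word cs x b)"
proof -
  have "lin sB (\<lambda>x. A_word cs x b)"
    by (induction cs) (simp_all add: multilinear_defs)
  then show "A_word cs (x + y) b = A_word cs x b + A_word cs y b"
    "A_word cs (sB a x) b = fscale a (A_word cs x b)"
    by (simp_all add: lin_def)
qed

lemma wlin_A_word: "wlin sC sB (\<lambda>(cs, b). A_word cs x b)"
proof (rule wlinI)
  fix us vs b
  have "lin sC (\<lambda>c. A_word (us @ c # vs) x b)"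
    by (induction us arbitrary: x) (simp_all add: multilinear_defs)
  then show "lin sC (\<lambda>c. case (us @ c # vs, b) of (cs, b) \<Rightarrow> A_word cs x b)" by simp
next
  fix cs
  have "lin sB (A_word cs x)"
    by (induction cs arbitrary: x) (simp_all add: multilinear_defs)
  then show "lin sB (\<lambda>b. case (cs, b) of (cs, b) \<Rightarrow> A_word cs x b)" by simp
qed

definition A :: "'b \<Rightarrow> ('c list \<times> 'b \<Rightarrow>\<^sub>0 'k) \<Rightarrow> ('c list \<times> 'b \<Rightarrow>\<^sub>0 'k)" where
  "A x = fext (\<lambda>(cs, b). A_word cs x b)"

lemma A_gen [simp]: "A x (gen (cs, b)) = A_word cs x b"
  by (simp add: A_def)

lemma A_pr [simp]: "A x (pr t) = A x t"
  unfolding A_def by (rule fext_pr[OF wlin_A_word])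

lemma lin_A: "lin fscale (A x)"
  unfolding A_def by (rule lin_fext)

lemmas A_add [simp] = lin_add[OF lin_A] and A_fscale [simp] = lin_scale[OF lin_A]
  and A_zero [simp] = lin_zero[OF lin_A] and A_minus [simp] = lin_minus[OF lin_A]
  and A_diff [simp] = lin_diff[OF lin_A] and A_sw = lin_hom_sw[OF lin_A]

lemma A_add_coeff [simp]: "A (x + y) t = A x t + A y t"
  and A_scale_coeff [simp]: "A (sB a x) t = fscale a (A x t)"
  unfolding A_def
  by (simp_all add: case_prod_beta' flip: fext_fun_add fext_fun_fscale)

lemma pr_A_word [simp]: "pr (A_word cs x b) = A_word cs x b"
  by (induction cs arbitrary: x) (simp_all add: pr_sw)

lemma pr_A [simp]: "pr (A x t) = A x t"
  unfolding A_def pr_fext by (simp add: case_prod_beta')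

lemma A_L: "A x (L c t) = sw3 (\<lambda>x1 x2 x3. L (Q x1 c x3) (A x2 t)) x"
proof (rule lin_eqI[where \<phi> = "\<lambda>t. A x (L c t)"])
  show "lin fscale (\<lambda>t. A x (L c t))" "lin fscale (\<lambda>t. sw3 (\<lambda>x1 x2 x3. L (Q x1 c x3) (A x2 t)) x)"
    by (simp_all add: lin_def)
  show "A x (L c (gen g)) = sw3 (\<lambda>x1 x2 x3. L (Q x1 c x3) (A x2 (gen g))) x" for g
    by (cases g) simp
qed

text \<open>The coproduct is multiplicative, hence so is its iterate; apply this twice and reorder
  the sums.\<close>

lemma sw3_mul:
  assumes f: "trilin sB f"
  shows "sw3 f (mul B x y)
    = sw3 (\<lambda>y1 y2 y3. sw3 (\<lambda>x1 x2 x3. f (mul B x1 y1) (mul B x2 y2) (mul B x3 y3)) x) y"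
proof -
  have f_simps: "f (u + u') = (\<lambda>v w. f u v w + f u' v w)" "f u (v + v') = (\<lambda>w. f u v w + f u v' w)"
    "f u v (w + w') = f u v w + f u v w'" "f (sB a u) = (\<lambda>v w. fscale a (f u v w))"
    "f u (sB a v) = (\<lambda>w. fscale a (f u v w))" "f u v (sB a w) = fscale a (f u v w)" for u u' v v' w w' a
    using f by (simp_all add: multilinear_defs fun_eq_iff)
  have "sw3 f (mul B x y) = sw B (\<lambda>x1 x'. sw B (\<lambda>y1 y'.
      sw B (\<lambda>u v. f (mul B x1 y1) u v) (mul B x' y')) y) x"
    by (rule B.sw_mul) (simp add: multilinear_defs f_simps)
  also have "\<dots> = sw B (\<lambda>x1 x'. sw B (\<lambda>y1 y'. sw B (\<lambda>x2 x3. sw B (\<lambda>y2 y3.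
      f (mul B x1 y1) (mul B x2 y2) (mul B x3 y3)) y') x') y) x"
    by (subst B.sw_mul) (simp_all add: multilinear_defs f_simps)
  \<comment> \<open>From here on only sums are exchanged: those over \<open>y\<close> move outside,
    the order in which \<open>A x (A y t)\<close> expands.\<close>
  also have "\<dots> = sw B (\<lambda>y1 y'. sw B (\<lambda>x1 x'. sw B (\<lambda>x2 x3. sw B (\<lambda>y2 y3.
      f (mul B x1 y1) (mul B x2 y2) (mul B x3 y3)) y') x') x) y"
    by (rule sw_swap)
  also have "\<dots> = sw B (\<lambda>y1 y'. sw B (\<lambda>x1 x'. sw B (\<lambda>y2 y3. sw B (\<lambda>x2 x3.
      f (mul B x1 y1) (mul B x2 y2) (mul B x3 y3)) x') y') x) y"
    by (subst (3) sw_swap) (rule refl)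
  also have "\<dots> = sw3 (\<lambda>y1 y2 y3. sw3 (\<lambda>x1 x2 x3. f (mul B x1 y1) (mul B x2 y2) (mul B x3 y3)) x) y"
    by (subst (2) sw_swap) (rule refl)
  finally show ?thesis .
qed

text \<open>On an empty word this is associativity in \<open>B\<close>; a letter is passed by
  multiplicativity of the iterated coproduct together with \<open>Q_mul\<close>.\<close>

lemma A_mul: "A (mul B x y) t = A x (A y t)"
proof -
  \<comment> \<open>The pair \<open>p\<close> serves as the index, so that the induction hypothesis
    covers all Sweedler factors of \<open>x\<close> and \<open>y\<close>.\<close>
  have "A (mul B (fst p) (snd p)) t = A (fst p) (A (snd p) t)" for p
  proof (rule operator_eqI[where \<phi> = "\<lambda>p. A (mul B (fst p) (snd p))"
        and \<psi> = "\<lambda>p t. A (fst p) (A (snd p) t)"])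
    fix p c t
    assume "\<And>p. A (mul B (fst p) (snd p)) t = A (fst p) (A (snd p) t)"
    from this[of "(_, _)"] have IH: "A (mul B x y) t = A x (A y t)" for x y by simp
    have "A (mul B x y) (L c t) = A x (A y (L c t))" for x y
    proof -
      have "A (mul B x y) (L c t) = sw3 (\<lambda>y1 y2 y3. sw3 (\<lambda>x1 x2 x3.
          L (Q (mul B x1 y1) c (mul B x3 y3)) (A (mul B x2 y2) t)) x) y"
        unfolding A_L by (rule sw3_mul) (simp add: multilinear_defs)
      also have "\<dots> = A x (A y (L c t))"
        by (simp only: A_L[of _ c] A_sw IH Q_mul A_L)
      finally show ?thesis .
    qed
    then show "A (mul B (fst p) (snd p)) (L c t) = A (fst p) (A (snd p) (L c t))" .
  qed (simp_all add: lin_A lin_def B.mul_assoc)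
  from this[of "(x, y)"] show ?thesis by simp
qed

text \<open>The unit is grouplike and acts trivially on letters. The value is \<open>pr t\<close>
  because all values of \<open>A\<close> are projected; one index suffices as the operator keeps its
  form when it passes a letter.\<close>

lemma A_unity: "A (unity B) t = pr t"
  using operator_eqI[where \<phi> = "\<lambda>_::unit. A (unity B)" and \<psi> = "\<lambda>_. pr" and t = t]
  by (simp add: lin_A lin_def B.mul_unity_left A_L B.sw_unity multilinear_defs)


section \<open>The product\<close>

text \<open>The product assembled from operators instead of Sweedler factors;
  \<open>pr_K_mult\<close> identifies it with the product of the complex.\<close>

definition M :: "('c list \<times> 'b \<Rightarrow>\<^sub>0 'k) \<Rightarrow> ('c list \<times> 'b \<Rightarrow>\<^sub>0 'k) \<Rightarrow> ('c list \<times> 'b \<Rightarrow>\<^sub>0 'k)" where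
  "M s t = fext (\<lambda>(cs, b). foldr L cs (A b t)) s"

lemma lin_foldr_L: "lin fscale (foldr L cs)"
  by (induction cs) (simp_all add: lin_def)

lemma foldr_L_simps [simp]:
  "foldr L cs (s + t) = foldr L cs s + foldr L cs t"
  "foldr L cs (fscale a t) = fscale a (foldr L cs t)"
  using lin_foldr_L[of cs] by (simp_all add: lin_def)

lemma wlin_foldr_L_A: "wlin sC sB (\<lambda>(cs, b). foldr L cs (A b t))"
  by (rule wlinI) (simp_all add: lin_def)

lemma M_gen [simp]: "M (gen (cs, b)) t = foldr L cs (A b t)"
  by (simp add: M_def)

lemma lin_M_left: "lin fscale (\<lambda>s. M s t)"
  unfolding M_def by (rule lin_fext)

lemma lin_M_right: "lin fscale (M s)"
  unfolding M_def by (rule linI) (simp_all add: case_prod_beta')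

lemmas M_add_left [simp] = lin_add[OF lin_M_left] and M_fscale_left [simp] = lin_scale[OF lin_M_left]
  and M_zero_left [simp] = lin_zero[OF lin_M_left] and M_minus_left [simp] = lin_minus[OF lin_M_left]
  and M_diff_left [simp] = lin_diff[OF lin_M_left] and M_sw_left = lin_hom_sw[OF lin_M_left]
  and M_fext_left = lin_hom_fext[OF lin_M_left]

lemmas M_add_right [simp] = lin_add[OF lin_M_right] and M_fscale_right [simp] = lin_scale[OF lin_M_right] and M_minus_right [simp] = lin_minus[OF lin_M_right]
  and M_diff_right [simp] = lin_diff[OF lin_M_right]

lemma M_pr_left [simp]: "M (pr s) t = M s t"
  unfolding M_def by (rule fext_pr[OF wlin_foldr_L_A])

lemma M_pr_right [simp]: "M s (pr t) = M s t"
  by (simp add: M_def)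

lemma pr_M [simp]: "pr (M s t) = M s t"
proof -
  have "pr (foldr L cs (A b t)) = foldr L cs (A b t)" for cs b
    by (cases cs) simp_all
  then show ?thesis
    unfolding M_def pr_fext by (simp add: case_prod_beta')
qed

lemma M_L: "M (L c s) t = L c (M s t)"
proof (rule lin_eqI[where \<phi> = "\<lambda>s. M (L c s) t"])
  show "M (L c (gen g)) t = L c (M (gen g) t)" for g
    by (cases g) simp
qed (simp_all add: lin_def)

text \<open>On an empty word this is \<open>A_mul\<close>; letters move out of the left factor by
  \<open>M_L\<close>.\<close>

lemma M_A: "M (A b s) t = A b (M s t)"
proof (rule operator_eqI[where \<phi> = "\<lambda>b s. M (A b s) t" and \<psi> = "\<lambda>b s. A b (M s t)"])
  fix b c s
  assume IH: "\<And>b. M (A b s) t = A b (M s t)"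
  show "M (A b (L c s)) t = A b (M (L c s) t)"
    by (simp only: A_L M_sw_left M_L IH)
qed (simp_all add: lin_def A_mul)

text \<open>\<open>M r\<close> is a combination of operators built from \<open>L\<close> and
  \<open>A\<close>, and both commute with right multiplication by \<open>t\<close>.\<close>

lemma M_assoc: "M (M r s) t = M r (M s t)"
proof -
  have "M (foldr L cs (A b s)) t = foldr L cs (A b (M s t))" for cs b
    by (induction cs) (simp_all add: M_A M_L)
  then have "M (M r s) t = fext (\<lambda>(cs, b). foldr L cs (A b (M s t))) r"
    by (simp add: M_def[of r s] M_fext_left case_prod_beta')
  then show ?thesis
    by (simp add: M_def[of r])
qed

lemma M_unity_left: "M (W [] (unity B)) t = pr t"
  by (simp add: A_unity)

lemma M_unity_right: "M s (W [] (unity B)) = pr s"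
  using operator_eqI[where \<phi> = "\<lambda>_::unit. \<lambda>s. M s (W [] (unity B))" and \<psi> = "\<lambda>_. pr" and t = s]
  by (simp add: lin_def M_L B.mul_unity_right)


section \<open>The derivation extending the comultiplication\<close>

text \<open>The graded Leibniz rule read as a recursion; the minus sign comes from moving
  \<open>D\<close> past one letter of degree one.\<close>

primrec D_word :: "'c list \<Rightarrow> 'b \<Rightarrow> ('c list \<times> 'b \<Rightarrow>\<^sub>0 'k)" where
  "D_word [] b = 0"
| "D_word (c # cs) b = sw C (\<lambda>c1 c2. W (c1 # c2 # cs) b) c - L c (D_word cs b)"

definition D :: "('c list \<times> 'b \<Rightarrow>\<^sub>0 'k) \<Rightarrow> ('c list \<times> 'b \<Rightarrow>\<^sub>0 'k)" where
  "D = fext (\<lambda>(cs, b). D_word cs b)"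

lemma W_add_Cons2 [simp]: "W (c # (x + y) # vs) b = W (c # x # vs) b + W (c # y # vs) b"
  and W_scale_Cons2 [simp]: "W (c # sC a x # vs) b = fscale a (W (c # x # vs) b)"
  and W_add_Cons2_letter [simp]: "W (c # c' # us @ (x + y) # vs) b
    = W (c # c' # us @ x # vs) b + W (c # c' # us @ y # vs) b"
  and W_scale_Cons2_letter [simp]: "W (c # c' # us @ sC a x # vs) b
    = fscale a (W (c # c' # us @ x # vs) b)"
  using W_add_letter[of "[c]"] W_scale_letter[of "[c]"]
    W_add_letter[of "c # c' # us"] W_scale_letter[of "c # c' # us"]
  by simp_all

lemma wlin_D_word: "wlin sC sB (\<lambda>(cs, b). D_word cs b)"
proof (rule wlinI)
  fix us vs b
  have "lin sC (\<lambda>c. D_word (us @ c # vs) b)"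
    by (induction us) (simp_all add: multilinear_defs free.scale_right_diff_distrib)
  then show "lin sC (\<lambda>c. case (us @ c # vs, b) of (cs, b) \<Rightarrow> D_word cs b)" by simp
next
  fix cs
  have "lin sB (D_word cs)"
    by (induction cs) (simp_all add: multilinear_defs free.scale_right_diff_distrib)
  then show "lin sB (\<lambda>b. case (cs, b) of (cs, b) \<Rightarrow> D_word cs b)" by simp
qed

lemma D_gen [simp]: "D (gen (cs, b)) = D_word cs b"
  by (simp add: D_def)

lemma D_pr [simp]: "D (pr t) = D t"
  unfolding D_def by (rule fext_pr[OF wlin_D_word])

lemma lin_D: "lin fscale D"
  unfolding D_def by (rule lin_fext)

lemmas D_add [simp] = lin_add[OF lin_D] and D_fscale [simp] = lin_scale[OF lin_D]
  and D_zero [simp] = lin_zero[OF lin_D] and D_minus [simp] = lin_minus[OF lin_D]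
  and D_diff [simp] = lin_diff[OF lin_D] and D_sw = lin_hom_sw[OF lin_D]

lemma D_L: "D (L c t) = sw C (\<lambda>c1 c2. L c1 (L c2 t)) c - L c (D t)"
proof (rule lin_eqI[where \<phi> = "\<lambda>t. D (L c t)"])
  show "D (L c (gen g)) = sw C (\<lambda>c1 c2. L c1 (L c2 (gen g))) c - L c (D (gen g))" for g
    by (cases g) simp
qed (simp_all add: lin_def free.scale_right_diff_distrib)

lemma pr_D [simp]: "pr (D t) = D t"
proof -
  have "pr (D_word cs b) = D_word cs b" for cs b
    by (induction cs) (simp_all add: pr_sw)
  then show ?thesis
    unfolding D_def pr_fext by (simp add: case_prod_beta')
qed

text \<open>For \<open>L c t\<close> the two terms with \<open>D t\<close> cancel because of their
  signs, and the two ways of splitting \<open>c\<close> into three letters cancel by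
  coassociativity.\<close>

lemma D_D: "D (D t) = 0"
proof -
  have "D (D (L c t)) = 0" if "D (D t) = 0" for c t
  proof -
    have "sw C (\<lambda>y w. sw C (\<lambda>u v. L u (L v (L w t))) y) c
        = sw C (\<lambda>u y. sw C (\<lambda>v w. L u (L v (L w t))) y) c"
      by (rule sw_coassoc) (simp add: multilinear_defs)
    then show ?thesis
      by (simp add: D_L D_sw L_sw that)
  qed
  then show ?thesis
    using operator_eqI[where \<phi> = "\<lambda>_::unit. \<lambda>t. D (D t)" and \<psi> = "\<lambda>_ _. 0" and t = t]
    by (simp add: lin_def)
qed

text \<open>Both sides split \<open>x\<close> into five factors; only the parenthesization differs.\<close>

lemma sw3_coassoc:
  assumes f: "\<And>v w y z. lin sB (\<lambda>u. f u v w y z)" "\<And>u w y z. lin sB (\<lambda>v. f u v w y z)"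
    "\<And>u v y z. lin sB (\<lambda>w. f u v w y z)" "\<And>u v w z. lin sB (\<lambda>y. f u v w y z)"
    "\<And>u v w y. lin sB (\<lambda>z. f u v w y z)"
  shows "sw3 (\<lambda>x1 x2 x3. sw B (\<lambda>u v. sw B (\<lambda>y z. f u v x2 y z) x3) x1) x
    = sw3 (\<lambda>x1 x2 x3. sw3 (\<lambda>v w y. f x1 v w y x3) x2) x"
proof -
  have f_simps [simp]:
    "f (u + u') = (\<lambda>v w y z. f u v w y z + f u' v w y z)"
    "f u (v + v') = (\<lambda>w y z. f u v w y z + f u v' w y z)"
    "f u v (w + w') = (\<lambda>y z. f u v w y z + f u v w' y z)"
    "f u v w (y + y') = (\<lambda>z. f u v w y z + f u v w y' z)"
    "f u v w y (z + z') = f u v w y z + f u v w y z'"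
    "f (sB a u) = (\<lambda>v w y z. fscale a (f u v w y z))"
    "f u (sB a v) = (\<lambda>w y z. fscale a (f u v w y z))"
    "f u v (sB a w) = (\<lambda>y z. fscale a (f u v w y z))"
    "f u v w (sB a y) = (\<lambda>z. fscale a (f u v w y z))"
    "f u v w y (sB a z) = fscale a (f u v w y z)" for u u' v v' w w' y y' z z' a
    using f by (simp_all add: lin_def fun_eq_iff)
  have "sw3 (\<lambda>x1 x2 x3. sw B (\<lambda>u v. sw B (\<lambda>y z. f u v x2 y z) x3) x1) x
      = sw B (\<lambda>x1 t. sw B (\<lambda>u v. sw B (\<lambda>x2 x3. sw B (\<lambda>y z. f u v x2 y z) x3) t) x1) x"
    by (subst (2) sw_swap) (rule refl)
  also have "\<dots> = sw B (\<lambda>u t. sw B (\<lambda>v t. sw B (\<lambda>x2 x3. sw B (\<lambda>y z. f u v x2 y z) x3) t) t) x"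
    by (rule B.sw_coassoc) (simp add: multilinear_defs)
  also have "\<dots> = sw B (\<lambda>u t. sw B (\<lambda>v t. sw B (\<lambda>p z. sw B (\<lambda>w y. f u v w y z) p) t) t) x"
    by (subst B.sw_coassoc) (simp_all add: multilinear_defs)
  also have "\<dots> = sw3 (\<lambda>x1 x2 x3. sw3 (\<lambda>v w y. f x1 v w y x3) x2) x"
    by (subst (2) B.sw_coassoc) (simp_all add: multilinear_defs)
  finally show ?thesis .
qed

text \<open>Split \<open>x\<close> into five factors. Splitting \<open>c\<close> after
  \<open>x\<close> has passed it and letting \<open>x\<close> pass \<open>c1\<close> and then
  \<open>c2\<close> both put factors 1 and 5 around \<open>c1\<close>, 2 and 4 around
  \<open>c2\<close>, and leave the third to act on \<open>t\<close>.\<close>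

lemma D_A: "D (A x t) = A x (D t)"
proof (rule operator_eqI[where \<phi> = "\<lambda>x t. D (A x t)" and \<psi> = "\<lambda>x t. A x (D t)"])
  fix x c t
  assume IH: "\<And>x. D (A x t) = A x (D t)"
  have "sw3 (\<lambda>x1 x2 x3. sw C (\<lambda>c1 c2. L c1 (L c2 (A x2 t))) (Q x1 c x3)) x
      = sw3 (\<lambda>x1 x2 x3. sw B (\<lambda>u v. sw C (\<lambda>c1 c2. sw B (\<lambda>y z.
          L (Q u c1 z) (L (Q v c2 y) (A x2 t))) x3) c) x1) x"
    by (subst sw_Q) (simp_all add: multilinear_defs)
  also have "\<dots> = sw3 (\<lambda>x1 x2 x3. sw B (\<lambda>u v. sw B (\<lambda>y z. sw C (\<lambda>c1 c2.
          L (Q u c1 z) (L (Q v c2 y) (A x2 t))) c) x3) x1) x"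
    by (subst sw_swap) (rule refl)
  also have "\<dots> = sw3 (\<lambda>x1 x2 x3. sw3 (\<lambda>v w y. sw C (\<lambda>c1 c2.
          L (Q x1 c1 x3) (L (Q v c2 y) (A w t))) c) x2) x"
    by (rule sw3_coassoc) (simp_all add: multilinear_defs)
  also have "\<dots> = sw C (\<lambda>c1 c2. sw3 (\<lambda>x1 x2 x3. sw3 (\<lambda>v w y.
          L (Q x1 c1 x3) (L (Q v c2 y) (A w t))) x2) x) c"
    by (simp only: sw_swap[where C = B and D = C])
  finally show "D (A x (L c t)) = A x (D (L c t))"
    by (simp add: A_L D_L D_sw A_sw L_sw IH)
qed (simp_all add: lin_def)

text \<open>The sign operator \<open>S t = (-1)\<^sup>n t\<close> for \<open>t\<close> of degree \<open>n\<close> removes all signs from the Leibniz rule.\<close>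

definition S :: "('c list \<times> 'b \<Rightarrow>\<^sub>0 'k) \<Rightarrow> ('c list \<times> 'b \<Rightarrow>\<^sub>0 'k)" where
  "S = fext (\<lambda>(cs, b). fscale ((- 1) ^ length cs) (W cs b))"

lemma S_gen [simp]: "S (gen (cs, b)) = fscale ((- 1) ^ length cs) (W cs b)"
  by (simp add: S_def)

lemma S_pr [simp]: "S (pr t) = S t"
  unfolding S_def by (rule fext_pr) (simp add: wlin_def lin_def free.scale_right_distrib mult.commute)

lemma lin_S: "lin fscale S"
  unfolding S_def by (rule lin_fext)

lemmas S_add [simp] = lin_add[OF lin_S] and S_fscale [simp] = lin_scale[OF lin_S]
  and S_zero [simp] = lin_zero[OF lin_S] and S_minus [simp] = lin_minus[OF lin_S]
  and S_diff [simp] = lin_diff[OF lin_S] and S_sw = lin_hom_sw[OF lin_S]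

lemma S_L [simp]: "S (L c t) = - L c (S t)"
proof (rule lin_eqI[where \<phi> = "\<lambda>t. S (L c t)"])
  show "S (L c (gen g)) = - L c (S (gen g))" for g
    by (cases g) simp
qed (simp_all add: lin_def free.scale_minus_right)

lemma S_A: "S (A x t) = A x (S t)"
proof (rule operator_eqI[where \<phi> = "\<lambda>x t. S (A x t)" and \<psi> = "\<lambda>x t. A x (S t)"])
  fix x c t
  assume IH: "\<And>x. S (A x t) = A x (S t)"
  show "S (A x (L c t)) = A x (S (L c t))"
    by (simp add: A_L S_sw IH)
qed (simp_all add: lin_def)

lemma S_S: "S (S t) = pr t"
  using operator_eqI[where \<phi> = "\<lambda>_::unit. \<lambda>t. S (S t)" and \<psi> = "\<lambda>_. pr" and t = t]
  by (simp add: lin_def)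

text \<open>\<open>D\<close> raises the degree by one.\<close>

lemma S_D: "S (D t) = - D (S t)"
  using operator_eqI[where \<phi> = "\<lambda>_::unit. \<lambda>t. S (D t)" and \<psi> = "\<lambda>_ t. - D (S t)" and t = t]
  by (simp add: lin_def D_L S_sw free.scale_minus_right)

lemma S_M: "S (M s t) = M (S s) (S t)"
  using operator_eqI[where \<phi> = "\<lambda>_::unit. \<lambda>s. S (M s t)" and \<psi> = "\<lambda>_ s. M (S s) (S t)" and t = s]
  by (simp add: lin_def M_L S_A)

text \<open>Coefficients have degree zero and commute with \<open>D\<close> by \<open>D_A\<close>;
  each letter contributes the same minus sign to \<open>D\<close> and to \<open>S\<close>.\<close>

lemma D_M: "D (M s t) = M (D s) t + M (S s) (D t)"
  using operator_eqI[where \<phi> = "\<lambda>_::unit. \<lambda>s. D (M s t)"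
      and \<psi> = "\<lambda>_ s. M (D s) t + M (S s) (D t)" and t = s]
  by (simp add: lin_def M_L D_L D_A M_sw_left free.scale_right_distrib)


section \<open>The differential\<close>

abbreviation e where "e \<equiv> W [\<I>] (unity B)"

text \<open>As \<open>L \<I> t\<close> is \<open>M e t\<close>, this is \<open>D\<close> minus the
  graded commutator with \<open>e\<close>; the operator \<open>S\<close> supplies the sign of the
  last term.\<close>

definition d :: "('c list \<times> 'b \<Rightarrow>\<^sub>0 'k) \<Rightarrow> ('c list \<times> 'b \<Rightarrow>\<^sub>0 'k)" where
  "d t = D t - L \<I> t + M (S t) e"

lemma lin_d: "lin fscale d"
  by (simp add: lin_def d_def free.scale_right_distrib free.scale_right_diff_distrib)

lemmas d_add [simp] = lin_add[OF lin_d] and d_fscale [simp] = lin_scale[OF lin_d]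

lemma d_pr [simp]: "d (pr t) = d t"
  by (simp add: d_def)

lemma M_e: "M e t = L \<I> t"
  by (simp add: A_unity)

lemma D_e: "D e = L \<I> e"
  by (simp add: sw_grouplike multilinear_defs)

text \<open>Beyond the Leibniz rule for \<open>D\<close>, the right-hand side contains
  \<open>M (S s) (L \<I> t)\<close> twice with opposite signs, once from each summand.\<close>

lemma d_M: "d (M s t) = M (d s) t + M (S s) (d t)"
  by (simp add: d_def D_M S_M M_L M_assoc M_e del: M_gen M_pr_left M_pr_right)

lemma d_d: "d (d t) = 0"
proof -
  have "D (L \<I> t) = L \<I> (L \<I> t) - L \<I> (D t)"
    by (simp add: D_L sw_grouplike multilinear_defs)
  moreover have "D (M (S t) e) = M (D (S t)) e + M t (L \<I> e)"
    by (simp only: D_M S_S M_pr_left D_e)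
  ultimately have "D (d t) = L \<I> (D t) - L \<I> (L \<I> t) + M (D (S t)) e + M t (L \<I> e)"
    by (simp add: d_def D_D del: M_pr_right)
  moreover have "S (M (S t) e) = - M t e"
    by (simp add: S_M S_S)
  then have "S (d t) = L \<I> (S t) - D (S t) - M t e"
    by (simp add: d_def S_D del: M_pr_right)
  then have "M (S (d t)) e = L \<I> (M (S t) e) - M (D (S t)) e - M t (L \<I> e)"
    by (simp only: M_diff_left M_L M_assoc M_e)
  ultimately show ?thesis
    \<comment> \<open>Only the outer \<open>d\<close> is expanded at first, so that the values of
      \<open>D (d t)\<close> and \<open>M (S (d t)) e\<close> apply; the inner one then remains in
      \<open>L \<I> (d t)\<close>.\<close>
    by (simp add: d_def[of "d t"] del: M_pr_right) (simp add: d_def)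
qed

end

section \<open>Supports of formal sums and iterated coproducts\<close>

lemma keys_fext_subset:
  assumes "\<And>x. x \<in> Poly_Mapping.keys t \<Longrightarrow> Poly_Mapping.keys (f x) \<subseteq> K"
  shows "Poly_Mapping.keys (fext f t) \<subseteq> K"
proof
  fix y
  assume "y \<in> Poly_Mapping.keys (fext f t)"
  then have "(\<Sum>x\<in>Poly_Mapping.keys t. Poly_Mapping.lookup t x * Poly_Mapping.lookup (f x) y) \<noteq> 0"
    by (simp add: in_keys_iff lin_ext_def lookup_sum)
  then obtain x where x: "x \<in> Poly_Mapping.keys t" and "Poly_Mapping.lookup (f x) y \<noteq> 0"
    by (metis (no_types, lifting) mult_zero_right sum.neutral)
  then have "y \<in> Poly_Mapping.keys (f x)" by (simp add: in_keys_iff)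
  then show "y \<in> K" using assms[OF x] by blast
qed

lemma keys_fscale_subset: "Poly_Mapping.keys (fscale a t) \<subseteq> Poly_Mapping.keys t"
  by (auto simp: in_keys_iff)

lemma keys_sweedlers:
  fixes C :: "('a::field, 'b, 'm) coalg_scheme"
  shows "Poly_Mapping.keys (sweedlers C n x) \<subseteq> {xs. length xs = Suc n}"
proof (induction n arbitrary: x)
  case (Suc n)
  show ?case
    unfolding sweedlers.simps
  proof (rule keys_fext_subset)
    fix p :: "'b \<times> 'b"
    obtain x1 x2 where p: "p = (x1, x2)" by fastforce
    have "Poly_Mapping.keys (fext (\<lambda>xs. gen (x1 # xs)) (sweedlers C n x2)) \<subseteq> {xs. length xs = Suc (Suc n)}"
      by (rule keys_fext_subset) (use Suc[of x2] in auto)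
    then show "Poly_Mapping.keys (case p of (x1, x2) \<Rightarrow> fext (\<lambda>xs. gen (x1 # xs)) (sweedlers C n x2))
        \<subseteq> {xs. length xs = Suc (Suc n)}"
      by (simp add: p)
  qed
qed simp

context coalgebra
begin

lemma fext_sweedlers_Suc:
  "fext F (sweedlers C (Suc n) x) = sw C (\<lambda>u y. fext (\<lambda>xs. F (u # xs)) (sweedlers C n y)) x"
  by (simp add: sw_def fext_fext case_prod_beta')

lemma lin_fext_sweedlers:
  assumes "\<And>us vs. lin (scale C) (\<lambda>x. F (us @ x # vs))"
  shows "lin (scale C) (\<lambda>x. fext F (sweedlers C n x))"
  using assms
proof (induction n arbitrary: F)
  case 0
  from 0[of "[]" "[]"] show ?case by simp
next
  case (Suc n)
  have "lin (scale C) (\<lambda>x. F (x # xs))" for xs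
    using Suc.prems[of "[]"] by simp
  moreover have "lin (scale C) (\<lambda>y. fext (\<lambda>xs. F (u # xs)) (sweedlers C n y))" for u
    using Suc.prems[of "u # _"] by (intro Suc.IH) simp
  ultimately have "bilin (scale C) (scale C) (\<lambda>u y. fext (\<lambda>xs. F (u # xs)) (sweedlers C n y))"
    by (simp add: bilin_def lin_def)
  then show ?case
    unfolding fext_sweedlers_Suc by (rule lin_sw)
qed

text \<open>\<open>sweedlers\<close> keeps splitting the last factor, so only the first one can be
  peeled off by definition. Coassociativity allows peeling at the other end, as needed for letters
  enclosed from both sides.\<close>

lemma fext_sweedlers_snoc:
  assumes "\<And>us vs. lin (scale C) (\<lambda>x. F (us @ x # vs))"
  shows "fext F (sweedlers C (Suc n) x)
    = sw C (\<lambda>y z. fext (\<lambda>xs. F (xs @ [z])) (sweedlers C n y)) x"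
  using assms
proof (induction n arbitrary: F x)
  case 0
  show ?case by (simp add: sw_def fext_fext case_prod_beta')
next
  case (Suc n)
  let ?f = "\<lambda>u y z. fext (\<lambda>xs. F (u # xs @ [z])) (sweedlers C n y)"
  have "lin (scale C) (\<lambda>x. F (x # xs @ [z]))" "lin (scale C) (\<lambda>z. F (u # xs @ [z]))" for u xs z
    using Suc.prems[of "[]"] Suc.prems[of "u # xs" "[]"] by simp_all
  moreover have "lin (scale C) (\<lambda>y. ?f u y z)" for u z
    using Suc.prems[of "u # _" "_ @ [z]"] by (intro lin_fext_sweedlers) simp
  ultimately have f: "trilin (scale C) ?f"
    by (simp add: trilin_def lin_def)
  have "fext F (sweedlers C (Suc (Suc n)) x)
      = sw C (\<lambda>u t. fext (\<lambda>xs. F (u # xs)) (sweedlers C (Suc n) t)) x"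
    by (rule fext_sweedlers_Suc)
  also have "\<dots> = sw C (\<lambda>u t. sw C (\<lambda>y z. ?f u y z) t) x"
    using Suc.prems[of "_ # _"] by (subst Suc.IH) simp_all
  also have "\<dots> = sw C (\<lambda>t z. sw C (\<lambda>u y. ?f u y z) t) x"
    by (rule sw_coassoc[OF f, symmetric])
  also have "\<dots> = sw C (\<lambda>t z. fext (\<lambda>xs. F (xs @ [z])) (sweedlers C (Suc n) t)) x"
    by (simp only: fext_sweedlers_Suc append_Cons)
  finally show ?case .
qed

end

context twisted_coefficients
begin

section \<open>Comparison with the product and the differential of the complex\<close>

text \<open>
  The value \<open>0\<close> on lists of the wrong length makes \<open>twist_word cs b'\<close> linear in every entry of
  every list, so that coassociativity applies to it without length conditions.
\<close>

primrec twist_word :: "'c list \<Rightarrow> 'b \<Rightarrow> 'b list \<Rightarrow> ('c list \<times> 'b \<Rightarrow>\<^sub>0 'k)" where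
  "twist_word [] b' bs = (case bs of [x] \<Rightarrow> W [] (mul B x b') | _ \<Rightarrow> 0)"
| "twist_word (c # cs) b' bs = (case bs of [] \<Rightarrow> 0
     | x # ys \<Rightarrow> if ys = [] then 0 else L (Q x c (last ys)) (twist_word cs b' (butlast ys)))"

lemma twist_word_multilinear: "lin sB (\<lambda>x. twist_word cs b' (us @ x # vs))"
proof (induction cs arbitrary: us vs)
  case Nil
  then show ?case by (cases us; cases vs) (auto simp: lin_def split: list.splits)
next
  case (Cons c cs)
  then show ?case by (cases us) (auto simp: lin_def butlast_append)
qed

text \<open>Removing the first and the last entry lowers positions by one and
  \<open>length cs\<close> by one, which keeps position \<open>j\<close> paired with
  \<open>2 * length cs - j\<close>.\<close>

lemma twist_word_eq:
  "length bs = Suc (2 * length cs) \<Longrightarrow> twist_word cs b' bs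
    = W (map (\<lambda>j. Q (bs ! j) (cs ! j) (bs ! (2 * length cs - j))) [0..<length cs])
        (mul B (bs ! length cs) b')"
proof (induction cs arbitrary: bs)
  case Nil
  then show ?case by (cases bs) auto
next
  case (Cons c cs)
  then obtain x zs where bs: "bs = x # zs" "length zs = Suc (Suc (2 * length cs))"
    by (cases bs) auto
  then obtain ys z where ys: "zs = ys @ [z]" "length ys = Suc (2 * length cs)"
    by (cases zs rule: rev_cases) auto
  have "map (\<lambda>j. Q (bs ! j) ((c # cs) ! j) (bs ! (2 * length (c # cs) - j))) [0..<length (c # cs)]
      = Q x c z # map (\<lambda>j. Q (ys ! j) (cs ! j) (ys ! (2 * length cs - j))) [0..<length cs]"
    by (simp add: map_upt_Suc bs(1) ys nth_append del: upt_Suc) (auto simp: nth_Cons' nth_append ys(2))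
  moreover have "bs ! length (c # cs) = ys ! length cs"
    by (simp add: bs ys nth_append)
  ultimately show ?case
    using Cons.IH[OF ys(2)] by (simp add: bs(1) ys(1))
qed

text \<open>\<open>A_word\<close> splits repeatedly in the middle, \<open>sweedlers\<close> at the
  end; peeling one factor off each end matches the two recursions.\<close>

lemma A_word_eq:
  "A_word cs b b' = fext (twist_word cs b') (sweedlers B (2 * length cs) b)"
proof (induction cs arbitrary: b)
  case (Cons c cs)
  have "fext (twist_word (c # cs) b') (sweedlers B (2 * length (c # cs)) b)
      = sw B (\<lambda>x y. fext (\<lambda>xs. twist_word (c # cs) b' (x # xs)) (sweedlers B (Suc (2 * length cs)) y)) b"
    by (simp add: sw_def fext_fext case_prod_beta')
  also have "\<dots> = sw B (\<lambda>x y. sw B (\<lambda>p z. fext (\<lambda>xs. twist_word (c # cs) b' (x # xs @ [z]))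
      (sweedlers B (2 * length cs) p)) y) b"
    by (subst B.fext_sweedlers_snoc) (use twist_word_multilinear[of "c # cs" b' "_ # _"] in simp_all)
  also have "\<dots> = A_word (c # cs) b b'"
    by (simp add: Cons.IH L_fext)
  finally show ?case by (rule sym)
qed simp

lemma foldr_L_W: "foldr L cs (W ds b) = W (cs @ ds) b"
  by (induction cs) simp_all

lemma pr_K_mult_gen: "pr (K_mult_gen B C \<alpha> \<beta> (cs, b) (cs', b')) = foldr L cs (A_word cs' b b')"
proof -
  \<comment> \<open>The closed form requires lists of length \<open>2 * length cs' + 1\<close>,
    which all lists in the support have.\<close>
  have "fext (twist_word cs' b') (sweedlers B (2 * length cs') b)
      = fext (\<lambda>bs. W (map (\<lambda>j. Q (bs ! j) (cs' ! j) (bs ! (2 * length cs' - j))) [0..<length cs'])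
          (mul B (bs ! length cs') b')) (sweedlers B (2 * length cs') b)"
    using keys_sweedlers[of B "2 * length cs'" b] by (intro fext_cong twist_word_eq) auto
  then show ?thesis
    by (simp add: K_mult_gen_def Let_def pr_fext A_word_eq lin_hom_fext[OF lin_foldr_L] foldr_L_W Q_def)
qed

definition K_mult :: "('c list \<times> 'b \<Rightarrow>\<^sub>0 'k) \<Rightarrow> ('c list \<times> 'b \<Rightarrow>\<^sub>0 'k) \<Rightarrow> ('c list \<times> 'b \<Rightarrow>\<^sub>0 'k)" where
  "K_mult s t = fext (\<lambda>g. fext (\<lambda>h. K_mult_gen B C \<alpha> \<beta> g h) t) s"

lemma pr_K_mult [simp]: "pr (K_mult s t) = M s t"
proof -
  have "pr (fext (\<lambda>h. K_mult_gen B C \<alpha> \<beta> g h) t) = M (gen g) t" for g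
  proof (rule lin_eqI[where \<phi> = "\<lambda>t. pr (fext (\<lambda>h. K_mult_gen B C \<alpha> \<beta> g h) t)"])
    show "pr (fext (\<lambda>h. K_mult_gen B C \<alpha> \<beta> g h) (gen h)) = M (gen g) (gen h)" for h
      by (cases g; cases h) (simp add: pr_K_mult_gen)
  qed (simp_all add: lin_def)
  then show ?thesis
    unfolding K_mult_def pr_fext lin_eq_fext[OF lin_M_left, of s t] by simp
qed

lemma M_K_mult_left: "M (K_mult r s) t = M r (M s t)"
  by (metis M_assoc M_pr_left pr_K_mult)

lemma M_K_mult_right: "M r (K_mult s t) = M r (M s t)"
  by (metis M_pr_right pr_K_mult)

lemma M_gen_unity_left: "M (gen ([], unity B)) t = pr t"
  using M_unity_left[of t] by (simp only: M_pr_left)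

lemma M_gen_unity_right: "M t (gen ([], unity B)) = pr t"
  using M_unity_right[of t] by (simp only: M_pr_right)

text \<open>Unrolling the recursion, the letter at position \<open>k\<close> is reached after
  passing \<open>k\<close> letters, hence the sign.\<close>

lemma D_word_eq:
  "D_word cs b = (\<Sum>k<length cs. fscale ((- 1) ^ k)
     (sw C (\<lambda>c1 c2. W (take k cs @ [c1, c2] @ drop (Suc k) cs) b) (cs ! k)))"
proof (induction cs)
  case (Cons c cs)
  show ?case
    unfolding length_Cons sum.lessThan_Suc_shift
    by (simp add: Cons.IH lin_sum[OF lin_L] L_sw sum_negf)
qed simp

lemma pr_K_diff_gen: "pr (K_diff_gen B C \<alpha> \<beta> \<I> (cs, b)) = d (gen (cs, b))"
proof -
  \<comment> \<open>Up to its sign, the last term of the differential is the product with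
    \<open>\<I>\<close> on the right: one letter on the right uses three factors of
    \<open>b\<close>.\<close>
  have "pr (fext (\<lambda>bs. gen (cs @ [ract C (lact C (\<alpha> (bs ! 0)) \<I>) (\<beta> (bs ! 2))], bs ! 1)) (sweedlers B 2 b))
      = pr (K_mult_gen B C \<alpha> \<beta> (cs, b) ([\<I>], unity B))"
    by (simp add: K_mult_gen_def Let_def B.mul_unity_right numeral_2_eq_2)
  then have "pr (fext (\<lambda>bs. gen (cs @ [ract C (lact C (\<alpha> (bs ! 0)) \<I>) (\<beta> (bs ! 2))], bs ! 1)) (sweedlers B 2 b))
      = foldr L cs (A b e)"
    by (simp add: pr_K_mult_gen del: A_word.simps)
  then show ?thesis
    by (simp add: K_diff_gen_def Let_def d_def D_word_eq pr_sum pr_fext sw_def case_prod_beta'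
        sum.atLeast1_atMost_eq del: A_gen)
qed

lemma pr_K_diff [simp]: "pr (fext (K_diff_gen B C \<alpha> \<beta> \<I>) t) = d t"
proof (rule lin_eqI[where \<phi> = "\<lambda>t. pr (fext (K_diff_gen B C \<alpha> \<beta> \<I>) t)"])
  show "pr (fext (K_diff_gen B C \<alpha> \<beta> \<I>) (gen g)) = d (gen g)" for g
    by (cases g) (simp add: pr_K_diff_gen)
qed (simp_all add: lin_def)


section \<open>The differential graded algebra\<close>

abbreviation R where "R \<equiv> (ring_of_type_algebra :: 'k ring)"
abbreviation K where "K \<equiv> K_algebra B C \<alpha> \<beta>"
abbreviation cl where "cl \<equiv> coset N"

lemma cl_eq_iff [simp]: "cl s = cl t \<longleftrightarrow> pr s = pr t"
  by (rule coset_eq_iff[OF null_words_subspace])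

lemma carrier_K: "carrier K = range cl"
  and one_K: "\<one>\<^bsub>K\<^esub> = cl (gen ([], unity B))"
  and zero_K: "\<zero>\<^bsub>K\<^esub> = cl 0"
  and add_K: "cl s \<oplus>\<^bsub>K\<^esub> cl t = cl (s + t)"
  and smult_K: "a \<odot>\<^bsub>K\<^esub> cl t = cl (fscale a t)"
  by (simp_all add: K_algebra_def Let_def qadd_coset[OF null_words_subspace]
      qscale_coset[OF null_words_subspace] del: cl_eq_iff)

lemma mult_K: "cl s \<otimes>\<^bsub>K\<^esub> cl t = cl (K_mult s t)"
proof -
  note N = null_words_subspace[of sC sB]
  \<comment> \<open>Both products project to \<open>M\<close>, which sees only the projections of
    its arguments.\<close>
  have K_mult: "pr (K_mult u v) = pr (K_mult s t)" if "u \<in> cl s" "v \<in> cl t" for u v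
    using that M_pr_left[of u v] M_pr_left[of s v] M_pr_right[of s v] M_pr_right[of s t]
    by (simp add: mem_coset_iff[OF N] del: M_pr_left M_pr_right)
  have "(\<Union>v\<in>cl t. cl (K_mult u v)) = cl (K_mult s t)" if "u \<in> cl s" for u
    using mem_coset_self[OF N, of t] K_mult[OF that] by (intro UN_coset[OF N]) auto
  then have "(\<lambda>u. \<Union>v\<in>cl t. cl (K_mult u v)) ` cl s = {cl (K_mult s t)}"
    using mem_coset_self[OF N, of s] by blast
  then have "(\<Union>u\<in>cl s. \<Union>v\<in>cl t. cl (K_mult u v)) = cl (K_mult s t)"
    by simp
  then show ?thesis
    by (simp add: K_algebra_def Let_def K_mult_def)
qed

lemma K_diff_cl: "K_diff B C \<alpha> \<beta> \<I> (cl t) = cl (fext (K_diff_gen B C \<alpha> \<beta> \<I>) t)"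
  unfolding K_diff_def by (rule qmap_coset[OF null_words_subspace null_words_subspace]) simp

lemmas K_simps = carrier_K one_K zero_K add_K smult_K mult_K K_diff_cl

lemma R_simps [simp]:
  "carrier R = UNIV" "a \<otimes>\<^bsub>R\<^esub> b = a * b" "a \<oplus>\<^bsub>R\<^esub> b = a + b" "\<one>\<^bsub>R\<^esub> = 1" "\<zero>\<^bsub>R\<^esub> = 0"
  by (simp_all add: ring_of_type_algebra_def)

lemma abelian_group_K: "abelian_group K"
proof (rule abelian_groupI)
  fix x
  assume "x \<in> carrier K"
  then obtain t where x: "x = cl t" by (auto simp: carrier_K)
  have "cl (- t) \<oplus>\<^bsub>K\<^esub> x = \<zero>\<^bsub>K\<^esub>" "cl (- t) \<in> carrier K"
    by (simp_all add: x K_simps rangeI)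
  then show "\<exists>y\<in>carrier K. y \<oplus>\<^bsub>K\<^esub> x = \<zero>\<^bsub>K\<^esub>" by blast
qed (auto simp: K_simps algebra_simps)

lemma module_K: "Module.module R K"
  by (rule moduleI)
     (auto simp: K_simps cring_from_type_algebra abelian_group_K free.scale_left_distrib free.scale_right_distrib)

lemma monoid_K: "Group.monoid K"
  by (rule monoidI) (auto simp: K_simps M_K_mult_left M_K_mult_right M_gen_unity_left M_gen_unity_right
      rangeI simp del: M_gen del: equalityI)

lemma ring_K: "Ring.ring K"
  by (rule ringI) (auto simp: K_simps abelian_group_K monoid_K rangeI del: equalityI)

lemma uminus_K: "\<ominus>\<^bsub>K\<^esub> cl t = cl (- t)"
proof -
  interpret abelian_group K by (rule abelian_group_K)
  show ?thesis by (rule minus_equality) (simp_all add: K_simps rangeI)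
qed

lemma sign_R: "(\<ominus>\<^bsub>R\<^esub> \<one>\<^bsub>R\<^esub>) [^]\<^bsub>R\<^esub> (n::nat) = (- 1) ^ n"
proof -
  interpret cring R by (rule cring_from_type_algebra)
  have "\<ominus>\<^bsub>R\<^esub> \<one>\<^bsub>R\<^esub> = - 1" by (rule minus_equality) simp_all
  then show ?thesis by (induction n) simp_all
qed

section \<open>The grading by word length\<close>

definition homogeneous :: "nat \<Rightarrow> ('c list \<times> 'b \<Rightarrow>\<^sub>0 'k) set" where
  "homogeneous n = {t. Poly_Mapping.keys t \<subseteq> {(cs, b). length cs = n}}"

lemma K_grade_eq: "K_grade B C n = cl ` homogeneous n"
  unfolding K_grade_def homogeneous_def by (rule arg_cong[where f = "image cl"]) auto

lemma homogeneous_subspace: "free.subspace (homogeneous n)"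
  by (rule free.subspaceI)
     (use Poly_Mapping.keys_add keys_fscale_subset in \<open>fastforce simp: homogeneous_def\<close>)+

lemma homogeneous_fext:
  assumes "\<And>x. x \<in> Poly_Mapping.keys t \<Longrightarrow> f x \<in> homogeneous n"
  shows "fext f t \<in> homogeneous n"
  unfolding homogeneous_def mem_Collect_eq
  by (rule keys_fext_subset) (use assms in \<open>simp add: homogeneous_def\<close>)

lemma homogeneous_gen [simp]: "gen (cs, b) \<in> homogeneous n \<longleftrightarrow> length cs = n"
  by (simp add: homogeneous_def)

lemma K_mult_homogeneous:
  assumes "s \<in> homogeneous m" "t \<in> homogeneous n"
  shows "K_mult s t \<in> homogeneous (m + n)"
proof -
  have "K_mult_gen B C \<alpha> \<beta> g h \<in> homogeneous (m + n)"
    if "g \<in> Poly_Mapping.keys s" "h \<in> Poly_Mapping.keys t" for g h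
  proof -
    have "g \<in> {(cs, b). length cs = m}" "h \<in> {(cs, b). length cs = n}"
      using that assms unfolding homogeneous_def by blast+
    then obtain cs b cs' b' where "g = (cs, b)" "h = (cs', b')" "length cs = m" "length cs' = n"
      by auto
    then show ?thesis
      by (auto simp: K_mult_gen_def Let_def intro!: homogeneous_fext)
  qed
  then show ?thesis
    unfolding K_mult_def by (intro homogeneous_fext)
qed

lemma K_diff_homogeneous:
  assumes "t \<in> homogeneous n"
  shows "fext (K_diff_gen B C \<alpha> \<beta> \<I>) t \<in> homogeneous (Suc n)"
proof (rule homogeneous_fext)
  fix g
  assume "g \<in> Poly_Mapping.keys t"
  then obtain cs b where g: "g = (cs, b)" "length cs = n"
    using assms by (auto simp: homogeneous_def)
  note subspace = homogeneous_subspace[of "Suc n"]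
  show "K_diff_gen B C \<alpha> \<beta> \<I> g \<in> homogeneous (Suc n)"
    unfolding g(1) K_diff_gen_def Let_def prod.case
    by (intro free.subspace_add[OF subspace] free.subspace_neg[OF subspace] free.subspace_sum[OF subspace]
        free.subspace_scale[OF subspace] homogeneous_fext) (auto simp: g(2))
qed

definition part :: "nat \<Rightarrow> ('c list \<times> 'b \<Rightarrow>\<^sub>0 'k) \<Rightarrow> ('c list \<times> 'b \<Rightarrow>\<^sub>0 'k)" where
  "part n = fext (\<lambda>(cs, b). if length cs = n then gen (cs, b) else 0)"

lemma part_homogeneous: "part n t \<in> homogeneous n"
  unfolding part_def
  by (rule homogeneous_fext) (auto simp: free.subspace_0[OF homogeneous_subspace])

lemma part_eq:
  assumes "t \<in> homogeneous m"
  shows "part n t = (if n = m then t else 0)"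
proof -
  have "part n t = fext (\<lambda>g. if n = m then gen g else 0) t"
    unfolding part_def using assms by (intro fext_cong) (auto simp: homogeneous_def)
  then show ?thesis by simp
qed

lemma sum_part:
  assumes "finite I" "(\<lambda>(cs, b). length cs) ` Poly_Mapping.keys t \<subseteq> I"
  shows "(\<Sum>n\<in>I. part n t) = t"
proof -
  have "(\<Sum>n\<in>I. part n t) = fext (\<lambda>g. \<Sum>n\<in>I. case g of (cs, b) \<Rightarrow> if length cs = n then gen (cs, b) else 0) t"
    unfolding part_def lin_ext_def by (subst sum.swap) (simp add: free.scale_sum_right)
  also have "\<dots> = fext gen t"
    using assms by (intro fext_cong) (auto split: prod.splits)
  finally show ?thesis by simp
qed

text \<open>Varying a letter or the coefficient does not change the length of a word, so taking
  components is multilinear and descends to classes.\<close>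

lemma pr_part: "pr (part n (pr t)) = pr (part n t)"
  unfolding part_def pr_fext
  by (rule fext_pr, rule wlinI) (auto simp: lin_def)

lemma pr_part_cong: "pr s = pr t \<Longrightarrow> pr (part n s) = pr (part n t)"
  by (metis pr_part)

lemma finsum_K: "finite I \<Longrightarrow> finsum K (\<lambda>n. cl (f n)) I = cl (\<Sum>n\<in>I. f n)"
proof (induction I rule: finite_induct)
  case empty
  interpret abelian_group K by (rule abelian_group_K)
  show ?case by (simp add: zero_K del: cl_eq_iff)
next
  case (insert n I)
  interpret abelian_group K by (rule abelian_group_K)
  show ?case
    using insert by (subst finsum_insert) (auto simp: K_simps simp del: cl_eq_iff)
qed

lemma K_direct_sum:
  assumes "x \<in> carrier K"
  shows "\<exists>!f. (\<forall>n. f n \<in> K_grade B C n) \<and> finite {n. f n \<noteq> \<zero>\<^bsub>K\<^esub>} \<and>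
    x = finsum K f {n. f n \<noteq> \<zero>\<^bsub>K\<^esub>}"
proof -
  obtain t where x: "x = cl t" using assms by (auto simp: carrier_K)
  let ?f = "\<lambda>n. cl (part n t)"
  let ?J = "(\<lambda>(cs, b). length cs) ` Poly_Mapping.keys t" and ?I = "{n. ?f n \<noteq> \<zero>\<^bsub>K\<^esub>}"
  have part_0: "part n t = 0" if "n \<notin> ?J" for n
  proof -
    have "part n t = fext (\<lambda>g. 0) t"
      unfolding part_def using that by (intro fext_cong) (auto split: prod.splits)
    then show ?thesis by simp
  qed
  have I: "?I \<subseteq> ?J"
  proof
    fix n
    assume "n \<in> ?I"
    then have "part n t \<noteq> 0" by (auto simp: zero_K)
    then show "n \<in> ?J" using part_0 by blast
  qed
  then have finite: "finite ?I" by (rule finite_subset) simp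
  \<comment> \<open>A nonzero component may still represent the zero class, so \<open>?I\<close> can
    be smaller than \<open>?J\<close>; the extra terms vanish under \<open>pr\<close>.\<close>
  have "pr (\<Sum>n\<in>?I. part n t) = pr (\<Sum>n\<in>?J. part n t)"
    unfolding pr_sum using I by (intro sum.mono_neutral_left) (auto simp: zero_K)
  then have "x = finsum K ?f ?I"
    by (simp only: finsum_K[OF finite] x cl_eq_iff sum_part[OF finite_imageI[OF finite_keys] order_refl])
  then have existence: "(\<forall>n. ?f n \<in> K_grade B C n) \<and> finite ?I \<and> x = finsum K ?f ?I"
    using finite part_homogeneous by (auto simp only: K_grade_eq)
  have unique: "f = ?f"
    if f: "\<forall>n. f n \<in> K_grade B C n" "finite {n. f n \<noteq> \<zero>\<^bsub>K\<^esub>}" "x = finsum K f {n. f n \<noteq> \<zero>\<^bsub>K\<^esub>}" for f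
  proof
    fix m
    let ?F = "{n. f n \<noteq> \<zero>\<^bsub>K\<^esub>}"
    have "\<forall>n. \<exists>u. f n = cl u \<and> u \<in> homogeneous n"
      using f(1) by (auto simp: K_grade_eq)
    then obtain u where u: "\<And>n. f n = cl (u n)" "\<And>n. u n \<in> homogeneous n" by metis
    have "f = (\<lambda>n. cl (u n))" using u(1) by blast
    then have "cl t = cl (\<Sum>n\<in>?F. u n)"
      using f(3) finsum_K[OF f(2), of u] x by (simp del: cl_eq_iff)
    \<comment> \<open>Uniqueness: taking components of degree \<open>m\<close>, which is well
      defined on classes, isolates \<open>u m\<close>.\<close>
    then have "pr (part m t) = pr (part m (\<Sum>n\<in>?F. u n))"
      by (intro pr_part_cong) simp
    also have "\<dots> = pr (\<Sum>n\<in>?F. if m = n then u n else 0)"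
      unfolding part_def fext_sum unfolding part_def[symmetric]
      by (simp add: part_eq[OF u(2)])
    \<comment> \<open>For \<open>m\<close> outside \<open>?F\<close> the class \<open>f m\<close> is
      zero, so \<open>pr (u m)\<close> is zero as well.\<close>
    also have "\<dots> = pr (u m)"
      using f(2) u(1)[of m] by (auto simp: zero_K sum.delta')
    finally show "f m = ?f m" by (simp add: u(1))
  qed
  show ?thesis
    by (rule ex1I[where a = ?f], rule existence, elim conjE, rule unique)
qed

text \<open>Turns \<open>S\<close> back into the scalar sign that the Leibniz axiom uses in degree
  \<open>n\<close>.\<close>

lemma S_homogeneous:
  assumes "s \<in> homogeneous n"
  shows "S s = fscale ((- 1) ^ n) (pr s)"
proof -
  have "S s = fext (\<lambda>g. fscale ((- 1) ^ n) (pr (gen g))) s"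
    unfolding S_def using assms by (intro fext_cong) (auto simp: homogeneous_def)
  also have "\<dots> = fscale ((- 1) ^ n) (pr (fext gen s))"
    by (simp only: fext_fun_fscale pr_fext)
  finally show ?thesis by simp
qed

lemma graded_algebra_K: "graded_algebra R K (K_grade B C)"
proof (intro graded_algebra.intro graded_algebra_axioms.intro)
  show "Ring.field R" by (rule field_from_type_algebra)
  show "submodule (K_grade B C n) R K" for n
  proof (rule module.submoduleI[OF module_K])
    note subspace = homogeneous_subspace[of n]
    show "\<zero>\<^bsub>K\<^esub> \<in> K_grade B C n"
      unfolding K_grade_eq zero_K using free.subspace_0[OF subspace] by blast
    show "\<ominus>\<^bsub>K\<^esub> a \<in> K_grade B C n" if "a \<in> K_grade B C n" for a
      using that free.subspace_neg[OF subspace] by (auto simp: K_grade_eq uminus_K simp del: cl_eq_iff)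
    show "a \<oplus>\<^bsub>K\<^esub> b \<in> K_grade B C n" if "a \<in> K_grade B C n" "b \<in> K_grade B C n" for a b
      using that free.subspace_add[OF subspace] by (auto simp: K_grade_eq add_K simp del: cl_eq_iff)
    show "a \<odot>\<^bsub>K\<^esub> b \<in> K_grade B C n" if "b \<in> K_grade B C n" for a b
      using that free.subspace_scale[OF subspace] by (auto simp: K_grade_eq smult_K simp del: cl_eq_iff)
  qed (auto simp: K_grade_eq carrier_K)
  show "x \<otimes>\<^bsub>K\<^esub> y \<in> K_grade B C (m + n)" if "x \<in> K_grade B C m" "y \<in> K_grade B C n" for x y m n
    using that K_mult_homogeneous by (auto simp: K_grade_eq mult_K simp del: cl_eq_iff)
  show "\<one>\<^bsub>K\<^esub> \<in> K_grade B C 0"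
    unfolding K_grade_eq one_K by (rule imageI) simp
  show "\<exists>!f. (\<forall>n. f n \<in> K_grade B C n) \<and> finite {n. f n \<noteq> \<zero>\<^bsub>K\<^esub>} \<and>
    x = finsum K f {n. f n \<noteq> \<zero>\<^bsub>K\<^esub>}" if "x \<in> carrier K" for x
    using that by (rule K_direct_sum)
qed (auto simp: module_K ring_K K_simps rangeI del: equalityI)

lemma dg_algebra_K: "dg_algebra R K (K_grade B C) (K_diff B C \<alpha> \<beta> \<I>)"
proof (rule dg_algebra.intro[OF graded_algebra_K], unfold_locales)
  fix x y n
  assume "x \<in> K_grade B C n" "y \<in> carrier K"
  then obtain s t where x: "x = cl s" "s \<in> homogeneous n" and y: "y = cl t"
    by (auto simp: K_grade_eq carrier_K)
  show "K_diff B C \<alpha> \<beta> \<I> (x \<otimes>\<^bsub>K\<^esub> y) = K_diff B C \<alpha> \<beta> \<I> x \<otimes>\<^bsub>K\<^esub> y \<oplus>\<^bsub>K\<^esub>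
      (\<ominus>\<^bsub>R\<^esub> \<one>\<^bsub>R\<^esub>) [^]\<^bsub>R\<^esub> n \<odot>\<^bsub>K\<^esub> (x \<otimes>\<^bsub>K\<^esub> K_diff B C \<alpha> \<beta> \<I> y)"
  proof -
    \<comment> \<open>The rule is known for \<open>M\<close> and \<open>d\<close>; since these see
      only projections, they can be exchanged with the operations on representatives.\<close>
    have "d (K_mult s t) = d (M s t)"
      by (metis d_pr pr_K_mult)
    also have "\<dots> = M (d s) t + fscale ((- 1) ^ n) (M s (d t))"
      by (simp add: d_M S_homogeneous[OF x(2)])
    also have "M (d s) t = M (fext (K_diff_gen B C \<alpha> \<beta> \<I>) s) t"
      by (metis M_pr_left pr_K_diff)
    also have "M s (d t) = M s (fext (K_diff_gen B C \<alpha> \<beta> \<I>) t)"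
      by (metis M_pr_right pr_K_diff)
    finally show ?thesis
      unfolding sign_R x(1) y by (simp add: K_simps)
  qed
next
  show "K_diff B C \<alpha> \<beta> \<I> x \<in> K_grade B C (Suc n)" if "x \<in> K_grade B C n" for x n
    using that K_diff_homogeneous by (auto simp: K_grade_eq K_diff_cl simp del: cl_eq_iff)
  show "K_diff B C \<alpha> \<beta> \<I> (K_diff B C \<alpha> \<beta> \<I> x) = \<zero>\<^bsub>K\<^esub>" if "x \<in> carrier K" for x
  proof -
    obtain t where "x = cl t" using \<open>x \<in> carrier K\<close> by (auto simp: carrier_K)
    moreover have "d (fext (K_diff_gen B C \<alpha> \<beta> \<I>) t) = 0"
      by (metis d_d d_pr pr_K_diff)
    ultimately show ?thesis by (simp add: K_simps)
  qed
qed (auto simp: K_simps)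

end

theorem proposition4p2:
  fixes B :: "('k::field, 'b::ab_group_add) bialg"
    and C :: "('k, 'c::ab_group_add, 'b) bimod_coalg"
    and \<alpha> \<beta> :: "'b \<Rightarrow> 'b"
    and \<I> :: 'c
  assumes "bialgebra B"
    and "bialgebra_hom B B \<alpha>"
    and "bialgebra_hom B (op_cop B) \<beta>"
    and "bimodule_coalgebra B C"
    and "comul C \<I> = coset (null2 (scale C)) (gen (\<I>, \<I>))"
  shows "dg_algebra (ring_of_type_algebra :: 'k ring)
    (K_algebra B C \<alpha> \<beta>) (K_grade B C) (K_diff B C \<alpha> \<beta> \<I>)"
proof -
  interpret twisted_coefficients B C \<alpha> \<beta> \<I>
    using assms by (intro twisted_coefficients.intro twisted_coefficients_axioms.intro)
  show ?thesis by (rule dg_algebra_K)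
qed

end
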